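(* Let $n$ be a positive integer, let $\theta^*\in\mathcal{U}_n$ be a unimodal sequence, let $\sigma>0$, and let $y=\theta^*+z$ where $z\sim N(0,\sigma^2 I_n)$. Let $m^*\in\{1,\dots,n\}$ be a mode of $\theta^*$, that is, $\theta^*\in C_{m^*}$. Let $s_1$ be the number of distinct values of $(\theta^*_1,\dots,\theta^*_{m^*})$ and $s_2$ the number of distinct values of $(\theta^*_{m^*+1},\dots,\theta^*_n)$. Let $\hat\theta\in\arg\min_{\theta\in\mathcal{U}_n}\|y-\theta\|^2$ be a least squares estimator. Then for every $\alpha>0$, $$\frac1n\|\hat\theta-\theta^*\|^2\le 12\,\sigma^2\Bigl(\frac{s_1+s_2}{n}\Bigr)\log\Bigl(\frac{en}{s_1+s_2}\Bigr)+48(\alpha+2)\,\sigma^2\,(s_1+s_2)\,\frac{\log n}{n}$$ with probability at least $1-4/n^{\alpha}$.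
   Context: $\|\cdot\|$ is the Euclidean norm on $\mathbb{R}^n$. For $1\le m\le n$ let $C_m=\{\theta\in\mathbb{R}^n:\theta_1\le\theta_2\le\dots\le\theta_m\ge\theta_{m+1}\ge\dots\ge\theta_n\}$, and let $\mathcal{U}_n=\bigcup_{m=1}^n C_m$ be the set of unimodal sequences of length $n$. Since $\mathcal{U}_n$ is closed but not convex, the least squares estimator may be non-unique; $\hat\theta$ denotes an arbitrary choice among the minimizers. If $m^*=n$, the second block is empty and $s_2=0$. *)

theory Defs
  imports "HOL-Probability.Probability"
begin

text \<open>
  The linearly ordered finite index type \<open>'n\<close> plays the role of \<open>{1, \<dots>, n}\<close> with
  \<open>n = CARD('n)\<close>: a sequence of length \<open>n\<close> is a vector in \<open>real ^ 'n\<close>, whose coordinates are read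
  in the order of \<open>'n\<close>. Every positive \<open>n\<close> is the cardinality of such a type.
\<close>

definition mode_cone :: "'n \<Rightarrow> (real ^ ('n::{finite,linorder})) set"
  where "mode_cone m =
    {\<theta>. mono_on {..m} (\<lambda>i. \<theta> $ i) \<and> antimono_on {m..} (\<lambda>i. \<theta> $ i)}"

definition unimodal :: "(real ^ ('n::{finite,linorder})) set"
  where "unimodal = (\<Union>m. mode_cone m)"

text \<open>The density of \<open>N(0, \<sigma>\<^sup>2 I)\<close>, with the determinant and inverse of the covariance
  matrix \<open>\<sigma>\<^sup>2 I\<close> written out. Here \<open>\<sigma>\<close> is the standard deviation, as in
  \<^const>\<open>normal_density\<close>.\<close>

definition isotropic_normal_density :: "real \<Rightarrow> real ^ 'n \<Rightarrow> real"
  where "isotropic_normal_density \<sigma> z =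
    exp (- (norm z)\<^sup>2 / (2 * \<sigma>\<^sup>2)) / sqrt ((2 * pi * \<sigma>\<^sup>2) ^ CARD('n))"

lemma isotropic_normal_density_eq_prod:
  fixes z :: "real ^ 'n"
  shows "isotropic_normal_density \<sigma> z = (\<Prod>i\<in>UNIV. normal_density 0 \<sigma> (z $ i))"
proof -
  have "(norm z)\<^sup>2 = (\<Sum>i\<in>UNIV. (z $ i)\<^sup>2)"
    by (simp add: norm_vec_def L2_set_def sum_nonneg)
  then show ?thesis
    by (simp add: isotropic_normal_density_def normal_density_def prod.distrib prod_dividef
        exp_sum sum_divide_distrib real_sqrt_power flip: sum_negf)
qed

end

theory Submission
  imports Defs
begin

text \<open>
  If \<open>m\<close> is a mode of the estimator, then the error \<open>\<Delta>\<close> is monotone on each block of a partition into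
  at most \<open>s\<^sub>1 + s\<^sub>2 + 1\<close> blocks: the constancy blocks of \<open>\<theta>\<^sup>*\<close>, one of which may be cut at \<open>m\<close>.
  Minimality gives \<open>\<bar>\<Delta>\<bar>\<^sup>2 \<le> 2 \<langle>z, \<Delta>\<rangle>\<close>, hence \<open>\<bar>\<Delta>\<bar> \<le> 2 F\<^sub>m(z)\<close>, where \<open>F\<^sub>m\<close> is the
  supremum of \<open>\<langle>z, v\<rangle>\<close> over the unit vectors \<open>v\<close> of the corresponding cone.

  Since \<open>F\<^sub>m\<^sup>2\<close> is at most the sum over the coordinates \<open>i\<close> of squares of positive parts of maxima of
  averages of \<open>\<plusminus>z\<close> over nested intervals containing \<open>i\<close>, Doob's \<open>L\<^sup>2\<close> inequality for reverse
  martingales bounds its expectation by \<open>4 \<sigma>\<^sup>2 (s\<^sub>1 + s\<^sub>2 + 1) (1 + ln n)\<close>: a coordinate at distance \<open>k\<close>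
  from the end of its block contributes \<open>2 \<sigma>\<^sup>2 / k\<close>. Since \<open>F\<^sub>m\<close> is 1-Lipschitz, the Prekopa--Leindler
  inequality applied to \<open>exp (F\<^sub>m\<^sup>2 / 12 \<sigma>\<^sup>2) \<phi>\<close>, \<open>exp (- F\<^sub>m\<^sup>2 / 8 \<sigma>\<^sup>2) \<phi>\<close> and the Gaussian density \<open>\<phi>\<close>
  turns this into an exponential tail bound, which survives a union bound over the \<open>n\<close> modes.
\<close>

subsection \<open>The Prekopa--Leindler inequality\<close>

text \<open>This turns a supremum over the points of an arbitrary set into a limit along an
  increasing sequence, so that continuity of measure from below applies to truncations.\<close>

lemma cofinal_sequence:
  fixes A :: "real set"
  assumes "A \<noteq> {}"
  obtains t :: "nat \<Rightarrow> real" where "incseq t" "\<And>n. \<exists>a\<in>A. t n \<le> a" "\<And>a. a \<in> A \<Longrightarrow> \<exists>n. a \<le> t n"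
proof (cases "bdd_above A")
  case bdd: True
  show thesis
  proof (cases "Sup A \<in> A")
    case True
    then show thesis
      using bdd by (intro that[of "\<lambda>_. Sup A"]) (auto intro: cSup_upper simp: incseq_def)
  next
    case False
    show thesis
    proof (rule that[of "\<lambda>n. Sup A - 1 / real (Suc n)"])
      show "incseq (\<lambda>n. Sup A - 1 / real (Suc n))"
        by (auto simp: incseq_def intro!: divide_left_mono)
      show "\<exists>a\<in>A. Sup A - 1 / real (Suc n) \<le> a" for n
      proof -
        have "Sup A - 1 / real (Suc n) < Sup A" by simp
        from less_cSupD[OF assms this] show ?thesis by (auto intro: less_imp_le)
      qed
      show "\<exists>n. a \<le> Sup A - 1 / real (Suc n)" if "a \<in> A" for a
      proof -
        have "a < Sup A"
          using cSup_upper[OF that bdd] that False by (metis order_le_less)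
        then obtain n where "inverse (real (Suc n)) < Sup A - a"
          using reals_Archimedean[of "Sup A - a"] by auto
        then show ?thesis
          by (intro exI[of _ n]) (simp add: inverse_eq_divide)
      qed
    qed
  qed
next
  case False
  show thesis
  proof (rule that[of real])
    show "\<exists>a\<in>A. real n \<le> a" for n
      using False by (meson bdd_aboveI linorder_le_cases)
  qed (auto simp: incseq_def real_arch_simple)
qed

text \<open>The cut points lie in \<open>A\<close> itself, so each truncated set has a largest
  element; the Brunn--Minkowski argument translates the other set by that element.\<close>

lemma emeasure_SUP_Iic:
  fixes A :: "real set"
  assumes [measurable]: "A \<in> sets borel" and "A \<noteq> {}"
  shows "emeasure lborel A = (SUP a\<in>A. emeasure lborel (A \<inter> {..a}))"
proof (rule antisym)
  obtain t where t: "incseq t" "\<And>n. \<exists>a\<in>A. t n \<le> a" "\<And>a. a \<in> A \<Longrightarrow> \<exists>n. a \<le> t n"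
    using cofinal_sequence[OF assms(2)] by metis
  have "A = (\<Union>n. A \<inter> {..t n})"
    using t(3) by blast
  moreover have "incseq (\<lambda>n. A \<inter> {..t n})"
    using t(1) by (fastforce simp: incseq_def)
  ultimately have "emeasure lborel A = (SUP n. emeasure lborel (A \<inter> {..t n}))"
    by (subst SUP_emeasure_incseq) auto
  also have "\<dots> \<le> (SUP a\<in>A. emeasure lborel (A \<inter> {..a}))"
  proof (rule SUP_mono)
    fix n
    obtain a where "a \<in> A" "t n \<le> a"
      using t(2) by blast
    then show "\<exists>a\<in>A. emeasure lborel (A \<inter> {..t n}) \<le> emeasure lborel (A \<inter> {..a})"
      by (intro bexI[of _ a] emeasure_mono) auto
  qed
  finally show "emeasure lborel A \<le> (SUP a\<in>A. emeasure lborel (A \<inter> {..a}))" .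
qed (auto intro!: SUP_least emeasure_mono)

lemma emeasure_uminus_image:
  fixes A :: "real set"
  assumes [measurable]: "A \<in> sets borel"
  shows "emeasure lborel (uminus ` A) = emeasure lborel A"
proof -
  have "uminus ` A = uminus -` A"
    by (force simp: image_iff)
  then show ?thesis
    using emeasure_distr[of uminus lborel borel A] by (simp add: lborel_distr_uminus)
qed

lemma emeasure_SUP_Ici:
  fixes A :: "real set"
  assumes [measurable]: "A \<in> sets borel" and "A \<noteq> {}"
  shows "emeasure lborel A = (SUP a\<in>A. emeasure lborel (A \<inter> {a..}))"
proof -
  have eq: "uminus ` B = uminus -` B" for B :: "real set"
    by (force simp: image_iff)
  have [measurable]: "uminus ` A \<in> sets borel"
    unfolding eq using measurable_sets[of uminus borel borel A] by simp
  have "emeasure lborel A = emeasure lborel (uminus ` A)"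
    by (simp add: emeasure_uminus_image)
  also have "\<dots> = (SUP a\<in>A. emeasure lborel (uminus ` A \<inter> {..- a}))"
    using assms(2) by (subst emeasure_SUP_Iic) (auto simp: image_comp comp_def)
  also have "\<dots> = (SUP a\<in>A. emeasure lborel (uminus ` (A \<inter> {a..})))"
    by (intro SUP_cong refl arg_cong[where f="emeasure lborel"]) auto
  also have "\<dots> = (SUP a\<in>A. emeasure lborel (A \<inter> {a..}))"
    by (intro SUP_cong refl emeasure_uminus_image) measurable
  finally show ?thesis .
qed

text \<open>The preimage on the right is the midpoint set (A + b) / 2, and scaling by one half
  halves Lebesgue measure.\<close>

lemma emeasure_half_shift:
  fixes A :: "real set"
  assumes [measurable]: "A \<in> sets borel"
  shows "emeasure lborel A = 2 * emeasure lborel {x. 2 * x - b \<in> A}"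
proof -
  have [measurable]: "{x. 2 * x - b \<in> A} \<in> sets borel"
    using measurable_sets[of "\<lambda>x. 2 * x - b" borel borel A] by (simp add: vimage_def)
  have "(\<integral>\<^sup>+x. indicator A x \<partial>lborel) = ennreal \<bar>2\<bar> * (\<integral>\<^sup>+x. indicator A (- b + 2 * x) \<partial>lborel)"
    by (rule nn_integral_real_affine) auto
  also have "(\<integral>\<^sup>+x. indicator A (- b + 2 * x) \<partial>lborel) = (\<integral>\<^sup>+x. indicator {x. 2 * x - b \<in> A} x \<partial>lborel)"
    by (intro nn_integral_cong) (auto simp: indicator_def)
  finally show ?thesis by simp
qed

text \<open>If \<open>A\<close> has a largest point a and \<open>B\<close> a smallest point b, then
  \<open>C\<close> contains (A + b) / 2 and (a + B) / 2. These meet at most in (a + b) / 2, so their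
  measures add. Truncation at points of \<open>A\<close> and \<open>B\<close> gives the general
  case. An arbitrary Borel set \<open>C\<close> stands in for the midpoint set, which avoids asking
  whether the latter is measurable.\<close>

lemma Brunn_Minkowski_real:
  fixes A B C :: "real set"
  assumes [measurable]: "A \<in> sets borel" "B \<in> sets borel" "C \<in> sets borel"
    and ne: "A \<noteq> {}" "B \<noteq> {}"
    and sub: "\<And>a b. a \<in> A \<Longrightarrow> b \<in> B \<Longrightarrow> (a + b) / 2 \<in> C"
  shows "emeasure lborel A + emeasure lborel B \<le> 2 * emeasure lborel C"
proof -
  have *: "emeasure lborel (A \<inter> {..a}) + emeasure lborel (B \<inter> {b..}) \<le> 2 * emeasure lborel C"
    if "a \<in> A" "b \<in> B" for a b
  proof -
    define C1 where "C1 = {x. 2 * x - b \<in> A \<inter> {..a}}"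
    define C2 where "C2 = {x. 2 * x - a \<in> B \<inter> {b..}}"
    have [measurable]: "C1 \<in> sets borel" "C2 \<in> sets borel"
      using measurable_sets[of "\<lambda>x. 2 * x - b" borel borel "A \<inter> {..a}"]
        measurable_sets[of "\<lambda>x. 2 * x - a" borel borel "B \<inter> {b..}"]
      by (simp_all add: vimage_def C1_def C2_def)
    have sub12: "C1 \<union> C2 \<subseteq> C"
    proof
      fix x assume "x \<in> C1 \<union> C2"
      then show "x \<in> C"
        using sub[of "2 * x - b" b] sub[of a "2 * x - a"] that by (auto simp: C1_def C2_def)
    qed
    have cap: "C1 \<inter> C2 \<subseteq> {(a + b) / 2}"
      by (auto simp: C1_def C2_def)
    have "emeasure lborel (A \<inter> {..a}) + emeasure lborel (B \<inter> {b..})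
        = 2 * (emeasure lborel C1 + emeasure lborel C2)"
      unfolding C1_def C2_def
      by (simp add: emeasure_half_shift[of "A \<inter> {..a}" b]
          emeasure_half_shift[of "B \<inter> {b..}" a] distrib_left del: Int_iff)
    also have "emeasure lborel C1 + emeasure lborel C2 = emeasure lborel (C1 \<union> C2)"
    proof -
      have "emeasure lborel (C1 \<inter> C2) \<le> emeasure lborel {(a + b) / 2}"
        using cap by (intro emeasure_mono) auto
      then have "C1 \<inter> C2 \<in> null_sets lborel"
        by (auto simp: null_sets_def)
      then show ?thesis
        using emeasure_Un'[of C1 lborel C2] by simp
    qed
    also have "\<dots> \<le> emeasure lborel C"
      using sub12 by (intro emeasure_mono) auto
    finally show ?thesis by (simp add: mult_left_mono)
  qed
  show ?thesis
    unfolding emeasure_SUP_Iic[OF assms(1) ne(1)] emeasure_SUP_Ici[OF assms(2) ne(2)]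
    using ne * by (simp add: ennreal_SUP_add_left[symmetric] ennreal_SUP_add_right SUP_le_iff)
qed

section \<open>Prekopa--Leindler inequality on the line\<close>

lemma layer_cake_unit:
  fixes u :: ennreal
  assumes "u \<le> 1"
  shows "(\<integral>\<^sup>+t. indicator {t. 0 < t \<and> t < 1 \<and> ennreal t < u} t \<partial>lborel) = u"
proof -
  obtain r where r: "0 \<le> r" "u = ennreal r"
    using assms by (cases u) (auto simp: top_unique)
  then have "r \<le> 1"
    using assms by simp
  then have "{t. 0 < t \<and> t < 1 \<and> ennreal t < u} = {0<..<r}"
    using r by (auto simp: ennreal_less_iff)
  then show ?thesis
    using r by simp
qed

lemma nn_integral_layer_cake_unit:
  fixes f :: "real \<Rightarrow> ennreal"
  assumes [measurable]: "f \<in> borel_measurable borel" and le: "\<And>x. f x \<le> 1"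
  shows "(\<integral>\<^sup>+x. f x \<partial>lborel) = (\<integral>\<^sup>+t. indicator {0<..<1} t * emeasure lborel {x. ennreal t < f x} \<partial>lborel)"
proof -
  have "(\<integral>\<^sup>+x. f x \<partial>lborel)
      = (\<integral>\<^sup>+x. (\<integral>\<^sup>+t. indicator {t. 0 < t \<and> t < 1 \<and> ennreal t < f x} t \<partial>lborel) \<partial>lborel)"
    by (intro nn_integral_cong layer_cake_unit[symmetric] le)
  also have "\<dots> = (\<integral>\<^sup>+t. (\<integral>\<^sup>+x. indicator {t. 0 < t \<and> t < 1 \<and> ennreal t < f x} t \<partial>lborel) \<partial>lborel)"
    by (rule lborel_pair.Fubini'[symmetric]) measurable
  also have "\<dots> = (\<integral>\<^sup>+t. (\<integral>\<^sup>+x. indicator {0<..<1} t * indicator {x. ennreal t < f x} x \<partial>lborel) \<partial>lborel)"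
    by (intro nn_integral_cong) (auto simp: indicator_def)
  also have "\<dots> = (\<integral>\<^sup>+t. indicator {0<..<1} t * emeasure lborel {x. ennreal t < f x} \<partial>lborel)"
    by (subst nn_integral_cmult) auto
  finally show ?thesis .
qed

lemma measurable_emeasure_superlevel [measurable]:
  fixes f :: "real \<Rightarrow> ennreal"
  assumes [measurable]: "f \<in> borel_measurable borel"
  shows "(\<lambda>t. emeasure lborel {x. ennreal t < f x}) \<in> borel_measurable borel"
proof -
  have "(\<lambda>t. \<integral>\<^sup>+x. indicator {x. ennreal t < f x} x \<partial>lborel) \<in> borel_measurable borel"
    unfolding indicator_def by measurable
  also have "(\<lambda>t. \<integral>\<^sup>+x. indicator {x. ennreal t < f x} x \<partial>lborel)
      = (\<lambda>t. emeasure lborel {x. ennreal t < f x})"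
    by (intro ext nn_integral_indicator) measurable
  finally show ?thesis .
qed

lemma ennreal_power2_less_imp_less:
  fixes a b :: ennreal
  assumes "a\<^sup>2 < b\<^sup>2"
  shows "a < b"
proof (rule ccontr)
  assume "\<not> a < b"
  then have "b\<^sup>2 \<le> a\<^sup>2"
    by (intro power_mono) auto
  with assms show False by simp
qed

text \<open>With both suprema equal to 1, the superlevel sets of \<open>f\<close> and
  \<open>g\<close> are nonempty at every level t in (0, 1), and their midpoints lie in the
  superlevel set of \<open>h\<close> at t. Brunn--Minkowski at each level and integration over t
  give the additive bound.\<close>

lemma Prekopa_Leindler_real_unit:
  fixes f g h :: "real \<Rightarrow> ennreal"
  assumes [measurable]: "f \<in> borel_measurable borel" "g \<in> borel_measurable borel" "h \<in> borel_measurable borel"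
    and f: "(SUP x. f x) = 1" and g: "(SUP x. g x) = 1"
    and fgh: "\<And>x y. f x * g y \<le> (h ((x + y) / 2))\<^sup>2"
  shows "(\<integral>\<^sup>+x. f x \<partial>lborel) + (\<integral>\<^sup>+x. g x \<partial>lborel) \<le> 2 * (\<integral>\<^sup>+x. h x \<partial>lborel)"
proof -
  \<comment> \<open>The cut at 1 lets the layer-cake formula over (0, 1) apply to \<open>h\<close>
    as well; levels below 1 do not see it.\<close>
  define h' where "h' x = min 1 (h x)" for x
  have [measurable]: "h' \<in> borel_measurable borel"
    unfolding h'_def by measurable
  have f1: "f x \<le> 1" and g1: "g x \<le> 1" for x
    using SUP_upper[of x UNIV f] SUP_upper[of x UNIV g] f g by auto
  have key: "emeasure lborel {x. ennreal t < f x} + emeasure lborel {x. ennreal t < g x}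
      \<le> 2 * emeasure lborel {x. ennreal t < h' x}" if t: "0 < t" "t < 1" for t
  proof (rule Brunn_Minkowski_real)
    have t1: "ennreal t < 1" using t by simp
    have "ennreal t < (SUP x. f x)" "ennreal t < (SUP x. g x)"
      using t1 by (simp_all only: f g)
    then show "{x. ennreal t < f x} \<noteq> {}" "{x. ennreal t < g x} \<noteq> {}"
      unfolding less_SUP_iff by blast+
    fix a b assume ab: "a \<in> {x. ennreal t < f x}" "b \<in> {x. ennreal t < g x}"
    have "f a < top" "g b < top"
      using f1[of a] g1[of b] by (auto intro: le_less_trans)
    then obtain p q where pq: "f a = ennreal p" "g b = ennreal q" "0 \<le> p" "0 \<le> q"
      by (cases "f a"; cases "g b") auto
    then have "t < p" "t < q"
      using ab t by (auto simp: ennreal_less_iff)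
    then have "t * t < p * q"
      using t by (intro mult_strict_mono) auto
    then have "ennreal t * ennreal t < f a * g b"
      using t pq by (simp add: ennreal_less_iff flip: ennreal_mult)
    then have "(ennreal t)\<^sup>2 < (h ((a + b) / 2))\<^sup>2"
      using fgh[of a b] by (simp add: power2_eq_square)
    then show "(a + b) / 2 \<in> {x. ennreal t < h' x}"
      using t1 by (auto simp: h'_def dest: ennreal_power2_less_imp_less)
  qed measurable
  have "(\<integral>\<^sup>+x. f x \<partial>lborel) + (\<integral>\<^sup>+x. g x \<partial>lborel) =
     (\<integral>\<^sup>+t. indicator {0<..<1} t * (emeasure lborel {x. ennreal t < f x} + emeasure lborel {x. ennreal t < g x}) \<partial>lborel)"
    unfolding nn_integral_layer_cake_unit[OF assms(1) f1] nn_integral_layer_cake_unit[OF assms(2) g1] distrib_left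
    by (rule nn_integral_add[symmetric]) measurable
  also have "\<dots> \<le> (\<integral>\<^sup>+t. 2 * (indicator {0<..<1} t * emeasure lborel {x. ennreal t < h' x}) \<partial>lborel)"
    using key by (intro nn_integral_mono) (auto simp: indicator_def)
  also have "\<dots> = 2 * (\<integral>\<^sup>+t. indicator {0<..<1} t * emeasure lborel {x. ennreal t < h' x} \<partial>lborel)"
    by (rule nn_integral_cmult) measurable
  also have "\<dots> = 2 * (\<integral>\<^sup>+x. h' x \<partial>lborel)"
    by (subst nn_integral_layer_cake_unit[where f=h']) (auto simp: h'_def)
  also have "\<dots> \<le> 2 * (\<integral>\<^sup>+x. h x \<partial>lborel)"
    by (intro mult_left_mono nn_integral_mono) (auto simp: h'_def)
  finally show ?thesis .
qed

text \<open>AM--GM for extended reals. It turns the additive inequality between normalized functions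
  into the multiplicative one.\<close>

lemma ennreal_mult_le_square_mean:
  fixes a b c :: ennreal
  assumes "a + b \<le> 2 * c"
  shows "a * b \<le> c\<^sup>2"
proof (cases "c = top")
  case True
  then show ?thesis by simp
next
  case False
  then have "a \<noteq> top" "b \<noteq> top"
    using assms by (auto simp: ennreal_mult_eq_top_iff top_unique)
  with False obtain a' b' c' where "0 \<le> a'" "0 \<le> b'" "0 \<le> c'" "a = ennreal a'" "b = ennreal b'" "c = ennreal c'"
    by (metis ennreal_cases)
  moreover from this have "ennreal (a' + b') \<le> ennreal (2 * c')"
    using assms by (simp add: ennreal_mult)
  then have "a' + b' \<le> 2 * c'"
    using \<open>0 \<le> c'\<close> by (subst (asm) ennreal_le_iff) auto
  then have "(a' + b')\<^sup>2 \<le> (2 * c')\<^sup>2"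
    using \<open>0 \<le> a'\<close> \<open>0 \<le> b'\<close> by (intro power_mono) auto
  then have "a' * b' \<le> c'\<^sup>2"
    using zero_le_power2[of "a' - b'"] by (simp add: power2_sum power2_diff power_mult_distrib)
  ultimately show ?thesis
    by (simp add: ennreal_power flip: ennreal_mult)
qed

lemma Prekopa_Leindler_real_bounded:
  fixes f g h :: "real \<Rightarrow> ennreal"
  assumes [measurable]: "f \<in> borel_measurable borel" "g \<in> borel_measurable borel" "h \<in> borel_measurable borel"
    and f: "(SUP x. f x) < top" and g: "(SUP x. g x) < top"
    and fgh: "\<And>x y. f x * g y \<le> (h ((x + y) / 2))\<^sup>2"
  shows "(\<integral>\<^sup>+x. f x \<partial>lborel) * (\<integral>\<^sup>+x. g x \<partial>lborel) \<le> (\<integral>\<^sup>+x. h x \<partial>lborel)\<^sup>2"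
proof (cases "(SUP x. f x) = 0 \<or> (SUP x. g x) = 0")
  case True
  then have "(\<forall>x. f x = 0) \<or> (\<forall>x. g x = 0)"
    by (auto simp: SUP_eq_iff bot_ennreal[symmetric] simp del: bot_ennreal)
  then show ?thesis by auto
next
  case False
  obtain a b where ab: "0 \<le> a" "0 \<le> b" "(SUP x. f x) = ennreal a" "(SUP x. g x) = ennreal b"
    using f g by (metis ennreal_cases less_irrefl)
  with False have pos: "0 < a" "0 < b" by (auto simp: less_le)
  \<comment> \<open>Scaling \<open>h\<close> by the geometric mean of the two suprema preserves the
    midpoint hypothesis when \<open>f\<close> and \<open>g\<close> are scaled to supremum 1.\<close>
  define c where "c = sqrt (a * b)"
  have c: "0 < c" "c\<^sup>2 = a * b" using pos by (simp_all add: c_def)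
  have cc: "(inverse (ennreal c))\<^sup>2 = inverse (ennreal a) * inverse (ennreal b)"
    using c pos by (simp add: inverse_ennreal ennreal_power power_inverse flip: ennreal_mult)
  let ?f = "\<lambda>x. inverse (ennreal a) * f x" and ?g = "\<lambda>x. inverse (ennreal b) * g x"
    and ?h = "\<lambda>x. inverse (ennreal c) * h x"
  have inv: "inverse (ennreal r) * ennreal r = 1" if "0 < r" for r
    using that by (simp add: inverse_ennreal flip: ennreal_mult)
  have "(\<integral>\<^sup>+x. ?f x \<partial>lborel) + (\<integral>\<^sup>+x. ?g x \<partial>lborel) \<le> 2 * (\<integral>\<^sup>+x. ?h x \<partial>lborel)"
  proof (rule Prekopa_Leindler_real_unit)
    show "(SUP x. ?f x) = 1" "(SUP x. ?g x) = 1"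
      using ab pos inv by (simp_all flip: SUP_mult_left_ennreal)
    fix x y
    have "?f x * ?g y = (inverse (ennreal a) * inverse (ennreal b)) * (f x * g y)"
      by (simp add: mult_ac)
    also have "\<dots> \<le> (inverse (ennreal c))\<^sup>2 * (h ((x + y) / 2))\<^sup>2"
      unfolding cc by (intro mult_left_mono fgh) simp
    finally show "?f x * ?g y \<le> (?h ((x + y) / 2))\<^sup>2"
      by (simp add: power_mult_distrib)
  qed measurable
  then have "(\<integral>\<^sup>+x. ?f x \<partial>lborel) * (\<integral>\<^sup>+x. ?g x \<partial>lborel) \<le> (\<integral>\<^sup>+x. ?h x \<partial>lborel)\<^sup>2"
    by (rule ennreal_mult_le_square_mean)
  moreover have cmult: "(\<integral>\<^sup>+x. k * u x \<partial>lborel) = k * (\<integral>\<^sup>+x. u x \<partial>lborel)"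
    if "u \<in> borel_measurable borel" for k :: ennreal and u :: "real \<Rightarrow> ennreal"
    using that by (intro nn_integral_cmult) simp
  ultimately have "(inverse (ennreal c))\<^sup>2 * ((\<integral>\<^sup>+x. f x \<partial>lborel) * (\<integral>\<^sup>+x. g x \<partial>lborel))
      \<le> (inverse (ennreal c))\<^sup>2 * (\<integral>\<^sup>+x. h x \<partial>lborel)\<^sup>2"
    unfolding cmult[OF assms(1)] cmult[OF assms(2)] cmult[OF assms(3)] power_mult_distrib cc
    by (simp add: mult_ac)
  then have "(ennreal c)\<^sup>2 * ((inverse (ennreal c))\<^sup>2 * ((\<integral>\<^sup>+x. f x \<partial>lborel) * (\<integral>\<^sup>+x. g x \<partial>lborel)))
      \<le> (ennreal c)\<^sup>2 * ((inverse (ennreal c))\<^sup>2 * (\<integral>\<^sup>+x. h x \<partial>lborel)\<^sup>2)"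
    by (rule mult_left_mono) simp
  moreover have "(ennreal c)\<^sup>2 * (inverse (ennreal c))\<^sup>2 = 1"
    using inv[OF c(1)] by (simp add: mult.commute flip: power_mult_distrib)
  ultimately show ?thesis
    by (simp flip: mult.assoc)
qed

text \<open>Truncating \<open>f\<close> and \<open>g\<close> at natural numbers keeps the midpoint
  hypothesis and makes them bounded; monotone convergence then removes the truncation.\<close>

lemma Prekopa_Leindler_real:
  fixes f g h :: "real \<Rightarrow> ennreal"
  assumes [measurable]: "f \<in> borel_measurable borel" "g \<in> borel_measurable borel" "h \<in> borel_measurable borel"
    and fgh: "\<And>x y. f x * g y \<le> (h ((x + y) / 2))\<^sup>2"
  shows "(\<integral>\<^sup>+x. f x \<partial>lborel) * (\<integral>\<^sup>+x. g x \<partial>lborel) \<le> (\<integral>\<^sup>+x. h x \<partial>lborel)\<^sup>2"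
proof -
  have trunc: "(\<integral>\<^sup>+x. u x \<partial>lborel) = (SUP n. \<integral>\<^sup>+x. min (of_nat n) (u x) \<partial>lborel)"
    if [measurable]: "u \<in> borel_measurable borel" for u :: "real \<Rightarrow> ennreal"
  proof -
    have "u x = (SUP n. min (of_nat n) (u x))" for x
    proof -
      have "(SUP n. inf (u x) (of_nat n)) = inf (u x) (SUP n. of_nat n)"
        by (simp add: inf_SUP)
      then show ?thesis
        by (simp add: ennreal_SUP_of_nat_eq_top inf_commute flip: inf_min)
    qed
    then have "(\<integral>\<^sup>+x. u x \<partial>lborel) = (\<integral>\<^sup>+x. (SUP n. min (of_nat n) (u x)) \<partial>lborel)"
      by (intro nn_integral_cong)
    also have "\<dots> = (SUP n. \<integral>\<^sup>+x. min (of_nat n) (u x) \<partial>lborel)"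
      by (rule nn_integral_monotone_convergence_SUP)
         (auto simp: incseq_def le_fun_def intro: min.coboundedI1)
    finally show ?thesis .
  qed
  have "(\<integral>\<^sup>+x. min (of_nat n) (f x) \<partial>lborel) * (\<integral>\<^sup>+x. min (of_nat k) (g x) \<partial>lborel) \<le> (\<integral>\<^sup>+x. h x \<partial>lborel)\<^sup>2" for n k
  proof (rule Prekopa_Leindler_real_bounded)
    show "(SUP x. min (of_nat n) (f x)) < top" "(SUP x. min (of_nat k) (g x)) < top"
      by (rule le_less_trans[OF SUP_least[of _ _ "of_nat n"]] le_less_trans[OF SUP_least[of _ _ "of_nat k"]];
          simp add: of_nat_less_top)+
    show "min (of_nat n) (f x) * min (of_nat k) (g y) \<le> (h ((x + y) / 2))\<^sup>2" for x y
      by (rule order_trans[OF mult_mono fgh]) auto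
  qed measurable
  then show ?thesis
    unfolding trunc[OF assms(1)] trunc[OF assms(2)] SUP_mult_left_ennreal SUP_mult_right_ennreal
    by (auto intro!: SUP_least)
qed

section \<open>Passage to several dimensions\<close>

text \<open>Induction on the coordinates: by the one-dimensional inequality, the three functions
  obtained by integrating out one coordinate satisfy the midpoint hypothesis again.\<close>

lemma Prekopa_Leindler_PiM:
  fixes f g h :: "('i \<Rightarrow> real) \<Rightarrow> ennreal"
  assumes "finite I"
    and "f \<in> borel_measurable (Pi\<^sub>M I (\<lambda>_. lborel))" "g \<in> borel_measurable (Pi\<^sub>M I (\<lambda>_. lborel))"
      "h \<in> borel_measurable (Pi\<^sub>M I (\<lambda>_. lborel))"
    and "\<And>x y. x \<in> extensional I \<Longrightarrow> y \<in> extensional I \<Longrightarrow> f x * g y \<le> (h (\<lambda>i\<in>I. (x i + y i) / 2))\<^sup>2"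
  shows "(\<integral>\<^sup>+x. f x \<partial>Pi\<^sub>M I (\<lambda>_. lborel)) * (\<integral>\<^sup>+x. g x \<partial>Pi\<^sub>M I (\<lambda>_. lborel))
    \<le> (\<integral>\<^sup>+x. h x \<partial>Pi\<^sub>M I (\<lambda>_. lborel))\<^sup>2"
proof -
  interpret product_sigma_finite "\<lambda>_::'i. lborel :: real measure" ..
  show ?thesis
    using assms
  proof (induction I arbitrary: f g h rule: finite_induct)
    case empty
    have "f (\<lambda>_. undefined) * g (\<lambda>_. undefined) \<le> (h (\<lambda>i\<in>{}. undefined))\<^sup>2"
      using empty.prems(4)[of "\<lambda>_. undefined" "\<lambda>_. undefined"] by (simp add: restrict_def)
    then show ?case
      by (simp add: nn_integral_empty restrict_def)
  next
    case (insert i I)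
    note [measurable] = insert.prems(1-3)
    have [measurable]: "(\<lambda>x. x(i := y)) \<in> Pi\<^sub>M I (\<lambda>_. lborel) \<rightarrow>\<^sub>M Pi\<^sub>M (insert i I) (\<lambda>_. lborel :: real measure)" for y :: real
      by (rule measurable_fun_upd[where J=I]) auto
    have [measurable]: "(\<lambda>y. x(i := y)) \<in> borel \<rightarrow>\<^sub>M Pi\<^sub>M (insert i I) (\<lambda>_. lborel :: real measure)"
      if "x \<in> space (Pi\<^sub>M I (\<lambda>_. lborel :: real measure))" for x
      using measurable_component_update[OF that insert.hyps(2)] by simp
    let ?F = "\<lambda>u x. \<integral>\<^sup>+y. u (x(i := y)) \<partial>(lborel :: real measure)"
    have meas: "?F u \<in> borel_measurable (Pi\<^sub>M I (\<lambda>_. lborel))"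
      if [measurable]: "u \<in> borel_measurable (Pi\<^sub>M (insert i I) (\<lambda>_. lborel))" for u :: "('i \<Rightarrow> real) \<Rightarrow> ennreal"
      by measurable
    have "(\<integral>\<^sup>+x. ?F f x \<partial>Pi\<^sub>M I (\<lambda>_. lborel)) * (\<integral>\<^sup>+x. ?F g x \<partial>Pi\<^sub>M I (\<lambda>_. lborel))
        \<le> (\<integral>\<^sup>+x. ?F h x \<partial>Pi\<^sub>M I (\<lambda>_. lborel))\<^sup>2"
    proof (rule insert.IH)
      fix x y :: "'i \<Rightarrow> real" assume xy: "x \<in> extensional I" "y \<in> extensional I"
      let ?m = "\<lambda>i\<in>I. (x i + y i) / 2"
      have sp: "x \<in> space (Pi\<^sub>M I (\<lambda>_. lborel))" "y \<in> space (Pi\<^sub>M I (\<lambda>_. lborel))"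
        "?m \<in> space (Pi\<^sub>M I (\<lambda>_. lborel))"
        using xy by (auto simp: space_PiM PiE_def)
      note [measurable] = sp
      show "?F f x * ?F g y \<le> (?F h ?m)\<^sup>2"
      proof (rule Prekopa_Leindler_real)
        fix s t :: real
        have "(\<lambda>j\<in>insert i I. ((x(i := s)) j + (y(i := t)) j) / 2) = ?m(i := (s + t) / 2)"
          using insert.hyps(2) by (auto simp: fun_eq_iff)
        moreover have "x(i := s) \<in> extensional (insert i I)" "y(i := t) \<in> extensional (insert i I)"
          using xy by (auto simp: extensional_def)
        ultimately show "f (x(i := s)) * g (y(i := t)) \<le> (h (?m(i := (s + t) / 2)))\<^sup>2"
          using insert.prems(4)[of "x(i := s)" "y(i := t)"] by (simp del: fun_upd_apply)
      qed measurable
    qed (intro meas, fact)+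
    then show ?case
      using insert.hyps by (simp add: product_nn_integral_insert)
  qed
qed

theorem Prekopa_Leindler:
  fixes f g h :: "'a::euclidean_space \<Rightarrow> ennreal"
  assumes [measurable]: "f \<in> borel_measurable borel" "g \<in> borel_measurable borel" "h \<in> borel_measurable borel"
    and fgh: "\<And>x y. f x * g y \<le> (h ((x + y) /\<^sub>R 2))\<^sup>2"
  shows "(\<integral>\<^sup>+x. f x \<partial>lborel) * (\<integral>\<^sup>+x. g x \<partial>lborel) \<le> (\<integral>\<^sup>+x. h x \<partial>lborel)\<^sup>2"
proof -
  let ?T = "\<lambda>x. \<Sum>b\<in>Basis. x b *\<^sub>R (b::'a)"
  have eq: "(\<integral>\<^sup>+x. u x \<partial>lborel) = (\<integral>\<^sup>+x. u (?T x) \<partial>Pi\<^sub>M Basis (\<lambda>_. lborel))"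
    if [measurable]: "u \<in> borel_measurable borel" for u :: "'a \<Rightarrow> ennreal"
    by (subst lborel_eq) (simp add: nn_integral_distr)
  show ?thesis
    unfolding eq[OF assms(1)] eq[OF assms(2)] eq[OF assms(3)]
  proof (rule Prekopa_Leindler_PiM)
    fix x y :: "'a \<Rightarrow> real"
    have "?T (\<lambda>b\<in>Basis. (x b + y b) / 2) = (?T x + ?T y) /\<^sub>R 2"
    proof -
      have "?T (\<lambda>b\<in>Basis. (x b + y b) / 2) = (\<Sum>b\<in>Basis. (1 / 2) *\<^sub>R ((x b + y b) *\<^sub>R b))"
        by (intro sum.cong) auto
      then show ?thesis
        by (simp add: scaleR_left_distrib sum.distrib flip: scaleR_sum_right)
    qed
    then show "f (?T x) * g (?T y) \<le> (h (?T (\<lambda>b\<in>Basis. (x b + y b) / 2)))\<^sup>2"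
      using fgh by simp
  qed auto
qed

subsection \<open>The isotropic Gaussian measure\<close>

definition gauss :: "real \<Rightarrow> (real ^ 'n) measure"
  where "gauss \<sigma> = density lborel (\<lambda>z. ennreal (isotropic_normal_density \<sigma> z))"

lemma isotropic_normal_density_measurable [measurable]:
  "isotropic_normal_density \<sigma> \<in> borel_measurable borel"
  unfolding isotropic_normal_density_def[abs_def] by measurable

lemma isotropic_normal_density_nonneg [simp]: "0 \<le> isotropic_normal_density \<sigma> z"
  by (simp add: isotropic_normal_density_def)

lemma sets_gauss [simp, measurable_cong]: "sets (gauss \<sigma>) = sets borel"
  and space_gauss [simp]: "space (gauss \<sigma>) = UNIV"
  by (simp_all add: gauss_def)

lemma nn_integral_gauss:
  assumes [measurable]: "f \<in> borel_measurable borel"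
  shows "(\<integral>\<^sup>+z. f z \<partial>gauss \<sigma>) = (\<integral>\<^sup>+z. ennreal (isotropic_normal_density \<sigma> z) * f z \<partial>lborel)"
  unfolding gauss_def by (rule nn_integral_density) measurable

lemma Basis_real_vec: "(Basis :: (real ^ 'n) set) = (\<lambda>i. axis i 1) ` UNIV"
  by (auto simp: Basis_vec_def)

lemma prod_Basis_real_vec: "(\<Prod>b\<in>(Basis :: (real ^ 'n) set). f b) = (\<Prod>i\<in>UNIV. f (axis i 1))"
  unfolding Basis_real_vec by (subst prod.reindex) (auto simp: inj_on_def axis_eq_axis)

text \<open>The density factorizes over the coordinates. This yields the total mass and the second
  moments.\<close>

lemma nn_integral_gauss_prod:
  fixes g :: "'n::finite \<Rightarrow> real \<Rightarrow> ennreal"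
  assumes [measurable]: "\<And>i. g i \<in> borel_measurable borel"
  shows "(\<integral>\<^sup>+z. (\<Prod>i\<in>UNIV. g i (z $ i)) \<partial>gauss \<sigma>)
    = (\<Prod>i\<in>UNIV. \<integral>\<^sup>+x. ennreal (normal_density 0 \<sigma> x) * g i x \<partial>lborel)"
proof -
  \<comment> \<open>Lebesgue measure is a product over basis vectors, so the factors are re-indexed
    from coordinates to basis vectors.\<close>
  define G where "G b x = ennreal (normal_density 0 \<sigma> x) * g (THE i. b = axis i 1) x" for b :: "real ^ 'n" and x
  have the: "(THE j. axis i 1 = axis j (1::real)) = i" for i :: 'n
    by (rule the_equality) (auto simp: axis_eq_axis)
  have "(\<integral>\<^sup>+z. (\<Prod>i\<in>UNIV. g i (z $ i)) \<partial>gauss \<sigma>)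
      = (\<integral>\<^sup>+z. (\<Prod>i\<in>UNIV. ennreal (normal_density 0 \<sigma> (z $ i)) * g i (z $ i)) \<partial>lborel)"
    by (subst nn_integral_gauss)
       (auto simp: isotropic_normal_density_eq_prod prod.distrib prod_ennreal intro!: nn_integral_cong)
  also have "\<dots> = (\<integral>\<^sup>+z. (\<Prod>b\<in>Basis. G b (z \<bullet> b)) \<partial>lborel)"
    by (simp add: prod_Basis_real_vec G_def the inner_axis)
  also have "\<dots> = (\<Prod>b\<in>Basis. \<integral>\<^sup>+x. G b x \<partial>lborel)"
    by (rule nn_integral_lborel_prod) (auto simp: G_def)
  also have "\<dots> = (\<Prod>i\<in>UNIV. \<integral>\<^sup>+x. ennreal (normal_density 0 \<sigma> x) * g i x \<partial>lborel)"
    by (simp add: prod_Basis_real_vec G_def the)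
  finally show ?thesis .
qed

lemma prob_space_gauss:
  assumes "0 < \<sigma>"
  shows "prob_space (gauss \<sigma> :: (real ^ 'n) measure)"
proof
  have "(\<integral>\<^sup>+x. ennreal (normal_density 0 \<sigma> x) \<partial>lborel) = 1"
    using assms by (subst nn_integral_eq_integral) auto
  then have "(\<integral>\<^sup>+z. (\<Prod>i\<in>(UNIV :: 'n set). 1) \<partial>(gauss \<sigma> :: (real ^ 'n) measure)) = 1"
    by (subst nn_integral_gauss_prod) auto
  then show "emeasure (gauss \<sigma> :: (real ^ 'n) measure) (space (gauss \<sigma>)) = 1"
    by simp
qed

lemma has_bochner_integral_gauss_square:
  fixes i :: "'n::finite"
  assumes "0 < \<sigma>"
  shows "has_bochner_integral (gauss \<sigma> :: (real ^ 'n) measure) (\<lambda>z. (z $ i)\<^sup>2) (\<sigma>\<^sup>2)"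
proof (rule has_bochner_integral_nn_integral)
  define g where "g j = (\<lambda>x::real. if j = i then ennreal (x\<^sup>2) else 1)" for j
  have one: "(\<integral>\<^sup>+x. ennreal (normal_density 0 \<sigma> x) \<partial>lborel) = 1"
    using assms by (subst nn_integral_eq_integral) auto
  have two: "(\<integral>\<^sup>+x. ennreal (normal_density 0 \<sigma> x) * ennreal (x\<^sup>2) \<partial>lborel) = ennreal (\<sigma>\<^sup>2)"
    using integral_normal_moment_even[of \<sigma> 0 1] integrable_normal_moment[of \<sigma> 0 2] assms
    by (subst ennreal_mult'[symmetric], simp, subst nn_integral_eq_integral) auto
  have "(\<integral>\<^sup>+z. ennreal ((z $ i)\<^sup>2) \<partial>gauss \<sigma>) = (\<integral>\<^sup>+z. (\<Prod>j\<in>UNIV. g j (z $ j)) \<partial>(gauss \<sigma> :: (real ^ 'n) measure))"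
    by (simp add: g_def prod.If_cases)
  also have "\<dots> = (\<Prod>j\<in>UNIV. \<integral>\<^sup>+x. ennreal (normal_density 0 \<sigma> x) * g j x \<partial>lborel)"
    by (rule nn_integral_gauss_prod) (simp add: g_def)
  also have "\<dots> = (\<Prod>j\<in>UNIV. if j = i then ennreal (\<sigma>\<^sup>2) else 1)"
    by (intro prod.cong) (auto simp: g_def one two)
  also have "\<dots> = ennreal (\<sigma>\<^sup>2)"
    by (simp add: prod.If_cases)
  finally show "(\<integral>\<^sup>+z. ennreal ((z $ i)\<^sup>2) \<partial>(gauss \<sigma> :: (real ^ 'n) measure)) = ennreal (\<sigma>\<^sup>2)" .
qed auto

lemma integrable_gauss_norm_square:
  assumes "0 < \<sigma>"
  shows "integrable (gauss \<sigma> :: (real ^ 'n) measure) (\<lambda>z. (norm z)\<^sup>2)"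
proof -
  have "(norm z)\<^sup>2 = (\<Sum>i\<in>UNIV. (z $ i)\<^sup>2)" for z :: "real ^ 'n"
    by (simp add: norm_vec_def L2_set_def sum_nonneg)
  then show ?thesis
    by (simp only:) (intro Bochner_Integration.integrable_sum
        integrable.intros[OF has_bochner_integral_gauss_square[OF assms]])
qed

text \<open>Coordinates, averages and maxima of averages are all bounded by the norm, so this single
  criterion covers their products.\<close>

lemma integrable_gauss_dominated:
  fixes f :: "real ^ 'n \<Rightarrow> real"
  assumes "0 < \<sigma>" "f \<in> borel_measurable borel" "\<And>z. \<bar>f z\<bar> \<le> c * (norm z)\<^sup>2"
  shows "integrable (gauss \<sigma>) f"
proof (rule Bochner_Integration.integrable_bound)
  show "integrable (gauss \<sigma> :: (real ^ 'n) measure) (\<lambda>z. c * (norm z)\<^sup>2)"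
    by (intro integrable_mult_right integrable_gauss_norm_square assms(1))
  show "AE z in gauss \<sigma>. norm (f z) \<le> norm (c * (norm z)\<^sup>2)"
    using assms(3) by (intro AE_I2) (metis abs_ge_self order_trans real_norm_def)
qed (use assms(2) in simp)

section \<open>Symmetries of the Gaussian measure\<close>

text \<open>The density depends on the norm alone. The lemma is applied to sign changes and to
  permutations of coordinates.\<close>

lemma distr_gauss_isometry:
  fixes T :: "real ^ 'n \<Rightarrow> real ^ 'n"
  assumes [measurable]: "T \<in> borel \<rightarrow>\<^sub>M borel"
    and "distr lborel borel T = lborel" and "\<And>z. norm (T z) = norm z"
  shows "distr (gauss \<sigma>) borel T = gauss \<sigma>"
proof -
  have "gauss \<sigma> = density (distr lborel borel T) (\<lambda>z. ennreal (isotropic_normal_density \<sigma> z))"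
    by (simp add: gauss_def assms(2))
  also have "\<dots> = distr (density lborel (\<lambda>z. ennreal (isotropic_normal_density \<sigma> (T z)))) borel T"
    by (rule density_distr) measurable
  also have "\<dots> = distr (gauss \<sigma>) borel T"
    by (simp add: gauss_def isotropic_normal_density_def assms(3))
  finally show ?thesis ..
qed

lemma integral_gauss_isometry:
  fixes T :: "real ^ 'n \<Rightarrow> real ^ 'n" and f :: "real ^ 'n \<Rightarrow> real"
  assumes [measurable]: "T \<in> borel \<rightarrow>\<^sub>M borel" "f \<in> borel_measurable borel"
    and "distr lborel borel T = lborel" and "\<And>z. norm (T z) = norm z"
  shows "(\<integral>z. f (T z) \<partial>gauss \<sigma>) = (\<integral>z. f z \<partial>gauss \<sigma>)"
proof -
  have "(\<integral>z. f z \<partial>gauss \<sigma>) = (\<integral>z. f z \<partial>distr (gauss \<sigma>) borel T)"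
    by (simp add: distr_gauss_isometry[OF assms(1,3,4)])
  also have "\<dots> = (\<integral>z. f (T z) \<partial>gauss \<sigma>)"
    by (rule integral_distr) measurable
  finally show ?thesis ..
qed

lemma distr_lborel_signs:
  fixes c :: "'n::finite \<Rightarrow> real"
  assumes "\<And>i. \<bar>c i\<bar> = 1"
  shows "distr lborel borel (\<lambda>z. \<chi> i. c i * z $ i) = (lborel :: (real ^ 'n) measure)"
proof -
  define C where "C b = c (THE i. b = axis i 1)" for b :: "real ^ 'n"
  have the: "(THE j. axis i 1 = axis j (1::real)) = i" for i :: 'n
    by (rule the_equality) (auto simp: axis_eq_axis)
  have "(\<Sum>b\<in>Basis. (C b * (z \<bullet> b)) *\<^sub>R b) = (\<chi> i. c i * z $ i)" for z :: "real ^ 'n"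
  proof -
    have "(\<Sum>b\<in>Basis. (C b * (z \<bullet> b)) *\<^sub>R b) = (\<Sum>i\<in>UNIV. (c i * z $ i) *\<^sub>R axis i 1)"
      unfolding Basis_real_vec
      by (subst sum.reindex) (auto simp: inj_on_def axis_eq_axis C_def the inner_axis)
    also have "\<dots> = (\<chi> i. c i * z $ i)"
      by (simp add: vec_eq_iff axis_def if_distrib[where f="\<lambda>x. _ * x"] cong: if_cong)
    finally show ?thesis .
  qed
  then have T: "(\<lambda>z. 0 + (\<Sum>b\<in>Basis. (C b * (z \<bullet> b)) *\<^sub>R b)) = (\<lambda>z::real ^ 'n. \<chi> i. c i * z $ i)"
    by auto
  have nz: "c i \<noteq> 0" for i
    using assms[of i] by auto
  have "lborel = density (distr lborel borel (\<lambda>z::real ^ 'n. \<chi> i. c i * z $ i)) (\<lambda>_. \<Prod>b\<in>Basis. \<bar>C b\<bar>)"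
    using lborel_affine_euclidean[of C "0 :: real ^ 'n"] nz unfolding T by (auto simp: Basis_real_vec C_def the)
  also have "(\<Prod>b\<in>Basis. \<bar>C b\<bar>) = 1"
    by (simp add: prod_Basis_real_vec C_def the assms)
  finally show ?thesis by (simp add: density_1)
qed

lemma measurable_vec_lambda [measurable (raw)]:
  fixes f :: "'n::finite \<Rightarrow> 'a \<Rightarrow> real"
  assumes "\<And>i. f i \<in> borel_measurable M"
  shows "(\<lambda>x. \<chi> i. f i x) \<in> borel_measurable M"
proof (rule borel_measurable_euclidean_space[THEN iffD2], intro ballI)
  fix b :: "real ^ 'n" assume "b \<in> Basis"
  then show "(\<lambda>x. (\<chi> i. f i x) \<bullet> b) \<in> borel_measurable M"
    using assms by (auto simp: Basis_real_vec inner_axis)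
qed

lemma integral_gauss_signs:
  fixes c :: "'n::finite \<Rightarrow> real" and f :: "real ^ 'n \<Rightarrow> real"
  assumes "\<And>i. \<bar>c i\<bar> = 1" "f \<in> borel_measurable borel"
  shows "(\<integral>z. f (\<chi> i. c i * z $ i) \<partial>gauss \<sigma>) = (\<integral>z. f z \<partial>gauss \<sigma>)"
proof (rule integral_gauss_isometry)
  show "norm (\<chi> i. c i * z $ i) = norm z" for z
    unfolding norm_vec_def by (intro L2_set_cong) (auto simp: abs_mult assms)
qed (use assms in \<open>auto simp: distr_lborel_signs\<close>)

text \<open>Lebesgue measure is determined by its values on boxes, and permuting coordinates turns a
  box into one with the same side lengths in another order.\<close>

lemma distr_lborel_permute:
  fixes \<pi> :: "'n::finite \<Rightarrow> 'n"
  assumes "bij \<pi>"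
  shows "distr lborel borel (\<lambda>z. \<chi> i. z $ \<pi> i) = (lborel :: (real ^ 'n) measure)"
proof (rule lborel_eqI[symmetric])
  fix l u :: "real ^ 'n" assume le: "\<And>b. b \<in> Basis \<Longrightarrow> l \<bullet> b \<le> u \<bullet> b"
  let ?T = "\<lambda>z::real ^ 'n. \<chi> i. z $ \<pi> i" and ?S = "\<lambda>z::real ^ 'n. \<chi> i. z $ inv \<pi> i"
  have inv: "inv \<pi> (\<pi> i) = i" "\<pi> (inv \<pi> i) = i" for i
    using assms by (auto simp: bij_is_inj bij_is_surj surj_f_inv_f)
  have "?T -` box l u = box (?S l) (?S u)"
    by (auto simp: mem_box Basis_real_vec inner_axis inv) (metis inv)+
  moreover have "(?S u - ?S l) \<bullet> b \<ge> 0" if "b \<in> Basis" for b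
  proof -
    obtain i where "b = axis i 1"
      using \<open>b \<in> Basis\<close> by (auto simp: Basis_real_vec)
    then show ?thesis
      using le[of "axis (inv \<pi> i) 1"] by (simp add: Basis_real_vec inner_axis)
  qed
  ultimately have "emeasure (distr lborel borel ?T) (box l u) = (\<Prod>b\<in>Basis. (?S u - ?S l) \<bullet> b)"
    by (subst emeasure_distr) (auto simp: emeasure_lborel_box inner_diff_left)
  also have "(\<Prod>b\<in>Basis. (?S u - ?S l) \<bullet> b) = (\<Prod>i\<in>UNIV. (u $ inv \<pi> i - l $ inv \<pi> i))"
    by (simp add: prod_Basis_real_vec inner_axis)
  also have "\<dots> = (\<Prod>i\<in>UNIV. (u $ i - l $ i))"
    using prod.reindex_bij_betw[OF bij_betw_inv_into[OF assms], of "\<lambda>i. u $ i - l $ i"] by simp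
  also have "\<dots> = (\<Prod>b\<in>Basis. (u - l) \<bullet> b)"
    by (simp add: prod_Basis_real_vec inner_axis)
  finally show "emeasure (distr lborel borel ?T) (box l u) = (\<Prod>b\<in>Basis. (u - l) \<bullet> b)" .
qed simp

lemma integral_gauss_permute:
  fixes \<pi> :: "'n::finite \<Rightarrow> 'n" and f :: "real ^ 'n \<Rightarrow> real"
  assumes "bij \<pi>" "f \<in> borel_measurable borel"
  shows "(\<integral>z. f (\<chi> i. z $ \<pi> i) \<partial>gauss \<sigma>) = (\<integral>z. f z \<partial>gauss \<sigma>)"
proof (rule integral_gauss_isometry)
  show "norm (\<chi> i. z $ \<pi> i) = norm z" for z :: "real ^ 'n"
    using sum.reindex_bij_betw[OF assms(1), of "\<lambda>i. (z $ i)\<^sup>2"] by (simp add: norm_vec_def L2_set_def)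
qed (use assms in \<open>auto simp: distr_lborel_permute\<close>)

text \<open>The parallelogram identity in exponential form. The factor exp (|x - y|^2 / (4
  \<sigma>^2)) is the excess log-concavity of the Gaussian, which pays for the quadratic cost in the
  concentration argument.\<close>

lemma isotropic_normal_density_midpoint:
  fixes x y :: "real ^ 'n"
  assumes "0 < \<sigma>"
  shows "isotropic_normal_density \<sigma> x * isotropic_normal_density \<sigma> y * exp ((norm (x - y))\<^sup>2 / (4 * \<sigma>\<^sup>2))
    = (isotropic_normal_density \<sigma> ((x + y) /\<^sub>R 2))\<^sup>2"
proof -
  have mid: "4 * (norm ((x + y) /\<^sub>R 2))\<^sup>2 = 2 * (norm x)\<^sup>2 + 2 * (norm y)\<^sup>2 - (norm (x - y))\<^sup>2"
    by (simp add: power2_norm_eq_inner inner_simps inner_commute algebra_simps)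
  have "- (norm x)\<^sup>2 / (2 * \<sigma>\<^sup>2) + - (norm y)\<^sup>2 / (2 * \<sigma>\<^sup>2) + (norm (x - y))\<^sup>2 / (4 * \<sigma>\<^sup>2)
      = 2 * (- (norm ((x + y) /\<^sub>R 2))\<^sup>2 / (2 * \<sigma>\<^sup>2))"
  proof -
    have "4 * N = 2 * X + 2 * Y - E \<Longrightarrow> - X / (2 * \<sigma>\<^sup>2) + - Y / (2 * \<sigma>\<^sup>2) + E / (4 * \<sigma>\<^sup>2) = 2 * (- N / (2 * \<sigma>\<^sup>2))"
      for N X Y E :: real
    proof -
      assume "4 * N = 2 * X + 2 * Y - E"
      then have N: "N = (2 * X + 2 * Y - E) / 4" by simp
      show ?thesis unfolding N using assms by (simp add: field_simps)
    qed
    from this[OF mid] show ?thesis .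
  qed
  then have "exp (- (norm x)\<^sup>2 / (2 * \<sigma>\<^sup>2)) * exp (- (norm y)\<^sup>2 / (2 * \<sigma>\<^sup>2)) * exp ((norm (x - y))\<^sup>2 / (4 * \<sigma>\<^sup>2))
      = (exp (- (norm ((x + y) /\<^sub>R 2))\<^sup>2 / (2 * \<sigma>\<^sup>2)))\<^sup>2"
    by (simp only: exp_add[symmetric] exp_double[symmetric])
  moreover have "a * b * e = c\<^sup>2 \<Longrightarrow> (a / r) * (b / r) * e = (c / r)\<^sup>2" for a b c e r :: real
    by (simp add: power2_eq_square)
  ultimately show ?thesis
    unfolding isotropic_normal_density_def by blast
qed

subsection \<open>Gaussian concentration\<close>

text \<open>Expanding (b - 2 d)^2 \<ge> 0 gives 2 (b + d)^2 \<le> 3 b^2 + 6 d^2; division by 24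
  \<sigma>^2 produces the constants 12, 8 and 4.\<close>

lemma square_transport_bound:
  fixes a b d \<sigma> :: real
  assumes "0 < \<sigma>" "0 \<le> a" "a \<le> b + d"
  shows "a\<^sup>2 / (12 * \<sigma>\<^sup>2) - b\<^sup>2 / (8 * \<sigma>\<^sup>2) \<le> d\<^sup>2 / (4 * \<sigma>\<^sup>2)"
proof -
  have "a\<^sup>2 \<le> (b + d)\<^sup>2"
    using assms by (intro power_mono) auto
  moreover have "0 \<le> (b - 2 * d)\<^sup>2" by simp
  ultimately have "2 * a\<^sup>2 - 3 * b\<^sup>2 \<le> 6 * d\<^sup>2"
    unfolding power2_sum power2_diff power_mult_distrib by simp
  moreover have "a\<^sup>2 / (12 * \<sigma>\<^sup>2) - b\<^sup>2 / (8 * \<sigma>\<^sup>2) = (2 * a\<^sup>2 - 3 * b\<^sup>2) / (24 * \<sigma>\<^sup>2)"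
    "d\<^sup>2 / (4 * \<sigma>\<^sup>2) = (6 * d\<^sup>2) / (24 * \<sigma>\<^sup>2)"
    using assms by (simp_all add: field_simps)
  ultimately show ?thesis
    using assms by (simp only:) (intro divide_right_mono, auto)
qed

text \<open>Maurey's inequality for the Gaussian measure and the quadratic cost \<open>\<bar>x - y\<bar>\<^sup>2 / 4\<close>.\<close>

lemma gauss_exp_moment_product:
  fixes F :: "real ^ 'n \<Rightarrow> real"
  assumes "0 < \<sigma>" and [measurable]: "F \<in> borel_measurable borel"
    and nonneg: "\<And>x. 0 \<le> F x" and lip: "\<And>x y. F x \<le> F y + norm (x - y)"
  shows "(\<integral>\<^sup>+x. ennreal (exp ((F x)\<^sup>2 / (12 * \<sigma>\<^sup>2))) \<partial>gauss \<sigma>)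
    * (\<integral>\<^sup>+x. ennreal (exp (- ((F x)\<^sup>2 / (8 * \<sigma>\<^sup>2)))) \<partial>gauss \<sigma>) \<le> 1"
proof -
  let ?\<phi> = "isotropic_normal_density \<sigma> :: real ^ 'n \<Rightarrow> real"
  have "(\<integral>\<^sup>+x. ennreal (?\<phi> x) * ennreal (exp ((F x)\<^sup>2 / (12 * \<sigma>\<^sup>2))) \<partial>lborel)
      * (\<integral>\<^sup>+x. ennreal (?\<phi> x) * ennreal (exp (- ((F x)\<^sup>2 / (8 * \<sigma>\<^sup>2)))) \<partial>lborel)
      \<le> (\<integral>\<^sup>+x. ennreal (?\<phi> x) \<partial>lborel)\<^sup>2"
  proof (rule Prekopa_Leindler)
    fix x y :: "real ^ 'n"
    have "exp ((F x)\<^sup>2 / (12 * \<sigma>\<^sup>2)) * exp (- ((F y)\<^sup>2 / (8 * \<sigma>\<^sup>2))) \<le> exp ((norm (x - y))\<^sup>2 / (4 * \<sigma>\<^sup>2))"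
      using square_transport_bound[OF assms(1) nonneg lip[of x y]] by (simp flip: exp_add)
    then have "?\<phi> x * ?\<phi> y * (exp ((F x)\<^sup>2 / (12 * \<sigma>\<^sup>2)) * exp (- ((F y)\<^sup>2 / (8 * \<sigma>\<^sup>2))))
        \<le> ?\<phi> x * ?\<phi> y * exp ((norm (x - y))\<^sup>2 / (4 * \<sigma>\<^sup>2))"
      by (rule mult_left_mono) simp
    then have "(?\<phi> x * exp ((F x)\<^sup>2 / (12 * \<sigma>\<^sup>2))) * (?\<phi> y * exp (- ((F y)\<^sup>2 / (8 * \<sigma>\<^sup>2))))
        \<le> (?\<phi> ((x + y) /\<^sub>R 2))\<^sup>2"
      unfolding isotropic_normal_density_midpoint[OF assms(1)] by (simp only: mult_ac)
    then show "ennreal (?\<phi> x) * ennreal (exp ((F x)\<^sup>2 / (12 * \<sigma>\<^sup>2)))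
        * (ennreal (?\<phi> y) * ennreal (exp (- ((F y)\<^sup>2 / (8 * \<sigma>\<^sup>2)))))
        \<le> (ennreal (?\<phi> ((x + y) /\<^sub>R 2)))\<^sup>2"
      by (simp add: ennreal_power ennreal_leI flip: ennreal_mult)
  qed measurable
  also have "(\<integral>\<^sup>+x. ennreal (?\<phi> x) \<partial>lborel) = (\<integral>\<^sup>+x. 1 \<partial>(gauss \<sigma> :: (real ^ 'n) measure))"
    by (subst nn_integral_gauss) auto
  also have "\<dots> = 1"
    using prob_space.emeasure_space_1[OF prob_space_gauss[OF assms(1), where 'n='n]] by simp
  finally show ?thesis
    by (simp add: nn_integral_gauss)
qed

text \<open>Jensen's inequality bounds the factor with negative exponent in
  \<open>gauss_exp_moment_product\<close> below by exp (- D / 8). The other factor is thus at most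
  exp (D / 8), and Markov's inequality gives the tail.\<close>

lemma gauss_concentration:
  fixes F :: "real ^ 'n \<Rightarrow> real"
  assumes \<sigma>: "0 < \<sigma>" and [measurable]: "F \<in> borel_measurable borel"
    and nonneg: "\<And>x. 0 \<le> F x" and lip: "\<And>x y. F x \<le> F y + norm (x - y)"
    and int: "integrable (gauss \<sigma>) (\<lambda>x. (F x)\<^sup>2)"
    and D: "(\<integral>x. (F x)\<^sup>2 \<partial>gauss \<sigma>) \<le> \<sigma>\<^sup>2 * D"
  shows "measure (gauss \<sigma>) {x. t < (F x)\<^sup>2} \<le> exp (D / 8 - t / (12 * \<sigma>\<^sup>2))"
proof -
  interpret prob_space "gauss \<sigma> :: (real ^ 'n) measure"
    by (rule prob_space_gauss[OF \<sigma>])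
  let ?X = "\<lambda>x. (F x)\<^sup>2 / (8 * \<sigma>\<^sup>2)"
  let ?A = "\<integral>\<^sup>+x. ennreal (exp ((F x)\<^sup>2 / (12 * \<sigma>\<^sup>2))) \<partial>gauss \<sigma>"
  let ?B = "\<integral>\<^sup>+x. ennreal (exp (- ?X x)) \<partial>gauss \<sigma>"
  have intX: "integrable (gauss \<sigma>) ?X"
    using int by simp
  have intE: "integrable (gauss \<sigma>) (\<lambda>x. exp (- ?X x))"
    by (rule integrable_const_bound[where B=1]) auto
  \<comment> \<open>Jensen through the tangent line of exp at \<open>- (D / 8)\<close>; by
    hypothesis the mean of \<open>?X\<close> is at most \<open>D / 8\<close>.\<close>
  have "exp (- (D / 8)) \<le> exp (- (D / 8)) * (1 + D / 8 - expectation ?X)"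
    using D \<sigma> by (simp add: field_simps)
  also have "\<dots> = expectation (\<lambda>x. exp (- (D / 8)) * (1 + D / 8 - ?X x))"
    using intX prob_space by simp
  also have "\<dots> \<le> expectation (\<lambda>x. exp (- ?X x))"
  proof (rule integral_mono)
    fix x
    have "exp (- (D / 8)) * (1 + (D / 8 - ?X x)) \<le> exp (- (D / 8)) * exp (D / 8 - ?X x)"
      by (intro mult_left_mono exp_ge_add_one_self) simp
    then show "exp (- (D / 8)) * (1 + D / 8 - ?X x) \<le> exp (- ?X x)"
      by (simp add: algebra_simps flip: exp_add)
  qed (use intX intE in auto)
  finally have B: "ennreal (exp (- (D / 8))) \<le> ?B"
    using intE by (subst nn_integral_eq_integral) (auto intro: ennreal_leI)
  \<comment> \<open>Markov's inequality for the exponential moment.\<close>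
  have "ennreal (exp (t / (12 * \<sigma>\<^sup>2))) * emeasure (gauss \<sigma>) {x. t < (F x)\<^sup>2}
      = (\<integral>\<^sup>+x. ennreal (exp (t / (12 * \<sigma>\<^sup>2))) * indicator {x. t < (F x)\<^sup>2} x \<partial>gauss \<sigma>)"
    by (subst nn_integral_cmult) auto
  also have "\<dots> \<le> ?A"
    using \<sigma> by (intro nn_integral_mono) (auto simp: indicator_def intro!: ennreal_leI divide_right_mono)
  finally have "(ennreal (exp (t / (12 * \<sigma>\<^sup>2))) * emeasure (gauss \<sigma>) {x. t < (F x)\<^sup>2}) * ennreal (exp (- (D / 8))) \<le> ?A * ?B"
    using B by (intro mult_mono) auto
  also have "\<dots> \<le> 1"
    by (rule gauss_exp_moment_product[OF \<sigma> assms(2) nonneg lip])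
  finally have "ennreal (exp (t / (12 * \<sigma>\<^sup>2)) * measure (gauss \<sigma>) {x. t < (F x)\<^sup>2} * exp (- (D / 8))) \<le> ennreal 1"
    by (simp add: emeasure_eq_measure ennreal_mult)
  then have "exp (t / (12 * \<sigma>\<^sup>2)) * measure (gauss \<sigma>) {x. t < (F x)\<^sup>2} * exp (- (D / 8)) \<le> 1"
    by (simp only: ennreal_le_iff zero_le_one)
  then have "measure (gauss \<sigma>) {x. t < (F x)\<^sup>2} * exp (t / (12 * \<sigma>\<^sup>2)) \<le> exp (D / 8)"
    by (simp add: exp_minus divide_simps mult.commute)
  then show ?thesis
    unfolding exp_diff by (simp add: pos_le_divide_eq)
qed

subsection \<open>Doob's inequality for nested averages\<close>

definition avg :: "'n set \<Rightarrow> real ^ 'n \<Rightarrow> real"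
  where "avg A z = (\<Sum>i\<in>A. z $ i) / real (card A)"

text \<open>The inserted 0 makes this the positive part of the largest average, with value 0 for the
  empty family, where the induction for Doob's inequality starts.\<close>

definition max_avg :: "'n set set \<Rightarrow> real ^ 'n \<Rightarrow> real"
  where "max_avg \<A> z = Max (insert 0 ((\<lambda>A. avg A z) ` \<A>))"

lemma avg_measurable [measurable]: "avg A \<in> borel_measurable borel"
  unfolding avg_def[abs_def] by measurable

lemma avg_uminus: "avg A (- z) = - avg A z"
  by (simp add: avg_def sum_negf)

lemma abs_avg_le_norm: "\<bar>avg A z\<bar> \<le> norm z"
proof (cases "A = {}")
  case False
  then have "0 < card A"
    by (simp add: card_gt_0_iff)
  moreover have "\<bar>\<Sum>i\<in>A. z $ i\<bar> \<le> real (card A) * norm z"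
    by (rule order_trans[OF sum_abs sum_bounded_above]) (rule component_le_norm_cart)
  ultimately show ?thesis
    by (simp add: avg_def divide_le_eq abs_divide mult.commute)
qed (simp add: avg_def)

lemma max_avg_empty [simp]: "max_avg {} z = 0"
  by (simp add: max_avg_def)

lemma max_avg_insert:
  fixes \<A> :: "'n::finite set set"
  shows "max_avg (insert A \<A>) z = max (avg A z) (max_avg \<A> z)"
  unfolding max_avg_def by (subst image_insert, subst insert_commute, subst Max_insert) auto

lemma max_avg_nonneg [simp]: "0 \<le> max_avg (\<A> :: 'n::finite set set) z"
  unfolding max_avg_def by (rule Max_ge) auto

lemma avg_le_max_avg: "A \<in> \<A> \<Longrightarrow> avg A z \<le> max_avg (\<A> :: 'n::finite set set) z"
  unfolding max_avg_def by (rule Max_ge) auto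

lemma max_avg_le_norm: "max_avg (\<A> :: 'n::finite set set) z \<le> norm z"
  unfolding max_avg_def using abs_avg_le_norm[of _ z] by (auto simp: abs_le_iff)

lemma max_avg_measurable [measurable]: "max_avg (\<A> :: 'n::finite set set) \<in> borel_measurable borel"
proof -
  have "finite \<A>" by simp
  then show ?thesis
  proof induction
    case (insert A \<A>)
    then show ?case
      unfolding max_avg_insert[abs_def] by measurable
  qed simp
qed

lemma avg_transpose:
  assumes "i \<in> A" "j \<in> A"
  shows "avg A (\<chi> k. z $ Transposition.transpose i j k) = avg A (z :: real ^ 'n)"
proof -
  have "bij_betw (Transposition.transpose i j) A A"
    using assms by (intro bij_betw_transpose_iff) simp
  then show ?thesis
    using sum.reindex_bij_betw[of _ A A "\<lambda>k. z $ k"] by (simp add: avg_def)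
qed

lemma max_avg_transpose:
  fixes \<A> :: "'n::finite set set"
  assumes "\<And>A. A \<in> \<A> \<Longrightarrow> i \<in> A \<and> j \<in> A"
  shows "max_avg \<A> (\<chi> k. z $ Transposition.transpose i j k) = max_avg \<A> z"
proof -
  have "(\<lambda>A. avg A (\<chi> k. z $ Transposition.transpose i j k)) ` \<A> = (\<lambda>A. avg A z) ` \<A>"
    using assms by (intro image_cong) (auto simp: avg_transpose)
  then show ?thesis
    by (simp only: max_avg_def)
qed

lemma product_le_norm_square:
  fixes z :: "real ^ 'n"
  assumes "\<bar>a\<bar> \<le> norm z" "\<bar>b\<bar> \<le> norm z"
  shows "\<bar>a * b\<bar> \<le> 1 * (norm z)\<^sup>2"
  using mult_mono[OF assms] by (simp add: abs_mult power2_eq_square)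

text \<open>Exchangeability of the coordinates replaces the martingale property in Doob's inequality.\<close>

lemma integral_gauss_symmetric_avg:
  fixes g :: "real ^ 'n \<Rightarrow> real"
  assumes "0 < \<sigma>" and [measurable]: "g \<in> borel_measurable borel"
    and bound: "\<And>z. \<bar>g z\<bar> \<le> norm z"
    and sym: "\<And>i j z. i \<in> A \<Longrightarrow> j \<in> A \<Longrightarrow> g (\<chi> k. z $ Transposition.transpose i j k) = g z"
    and A0: "A0 \<subseteq> A" "A0 \<noteq> {}"
  shows "(\<integral>z. g z * avg A z \<partial>gauss \<sigma>) = (\<integral>z. g z * avg A0 z \<partial>gauss \<sigma>)"
proof -
  obtain i0 where i0: "i0 \<in> A0"
    using A0 by blast
  have int: "integrable (gauss \<sigma>) (\<lambda>z. g z * z $ i)" for i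
    by (rule integrable_gauss_dominated[OF assms(1) _ product_le_norm_square[OF bound component_le_norm_cart]]) measurable
  \<comment> \<open>Swapping i and i0 changes neither \<open>g\<close> nor the Gaussian measure, so
    all coordinates in \<open>A\<close> have the same correlation with \<open>g\<close>.\<close>
  have same: "(\<integral>z. g z * z $ i \<partial>gauss \<sigma>) = (\<integral>z. g z * z $ i0 \<partial>gauss \<sigma>)" if "i \<in> A" for i
  proof -
    have "(\<integral>z. g z * z $ i \<partial>gauss \<sigma>)
        = (\<integral>z. g (\<chi> k. z $ Transposition.transpose i i0 k) * (\<chi> k. z $ Transposition.transpose i i0 k) $ i \<partial>gauss \<sigma>)"
      by (rule integral_gauss_permute[symmetric]) auto
    also have "\<dots> = (\<integral>z. g z * z $ i0 \<partial>gauss \<sigma>)"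
      using that i0 A0 by (subst sym) auto
    finally show ?thesis .
  qed
  have "(\<integral>z. g z * avg B z \<partial>gauss \<sigma>) = (\<integral>z. g z * z $ i0 \<partial>gauss \<sigma>)" if "B \<subseteq> A" "B \<noteq> {}" for B
  proof -
    have "(\<integral>z. g z * avg B z \<partial>gauss \<sigma>) = (\<integral>z. (\<Sum>i\<in>B. g z * z $ i) / real (card B) \<partial>gauss \<sigma>)"
      by (simp add: avg_def sum_distrib_left)
    also have "\<dots> = (\<Sum>i\<in>B. \<integral>z. g z * z $ i \<partial>gauss \<sigma>) / real (card B)"
      using int by simp
    also have "\<dots> = (\<Sum>i\<in>B. \<integral>z. g z * z $ i0 \<partial>gauss \<sigma>) / real (card B)"
      using that by (intro arg_cong2[where f="(/)"] sum.cong same) auto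
    also have "\<dots> = (\<integral>z. g z * z $ i0 \<partial>gauss \<sigma>)"
      using that by (simp add: card_gt_0_iff)
    finally show ?thesis .
  qed
  from this[of A] this[of A0] show ?thesis
    using A0 by auto
qed

text \<open>Doob's argument with the sets of the chain added from the largest to the smallest. The
  increment \<open>g\<close> caused by the smallest set A involves only averages over sets
  containing A. It is therefore symmetric in the coordinates of A, and its correlation with the
  average over A equals that with the average over \<open>A0\<close>. The increments
  telescope.\<close>

lemma integral_gauss_max_avg_square_le_prod:
  fixes \<A> :: "'n::finite set set"
  assumes \<sigma>: "0 < \<sigma>" and "A0 \<noteq> {}" "\<And>A. A \<in> \<A> \<Longrightarrow> A0 \<subseteq> A"
    and "\<And>A B. A \<in> \<A> \<Longrightarrow> B \<in> \<A> \<Longrightarrow> A \<subseteq> B \<or> B \<subseteq> A"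
  shows "(\<integral>z. (max_avg \<A> z)\<^sup>2 \<partial>gauss \<sigma>) \<le> 2 * (\<integral>z. max_avg \<A> z * max 0 (avg A0 z) \<partial>gauss \<sigma>)"
  using assms(3,4)
proof (induction "card \<A>" arbitrary: \<A>)
  case 0
  then have "\<A> = {}" by simp
  then show ?case by simp
next
  case (Suc k)
  have "\<A> \<noteq> {}" "finite \<A>"
    using Suc.hyps(2) by auto
  then obtain A where A: "A \<in> \<A>" "\<And>B. B \<in> \<A> \<Longrightarrow> B \<subseteq> A \<Longrightarrow> A = B"
    using finite_has_minimal[of \<A>] by blast
  have least: "A \<subseteq> B" if "B \<in> \<A>" for B
    using Suc.prems(2)[OF A(1) that] A(2)[OF that] by blast
  define \<B> where "\<B> = \<A> - {A}"
  have \<A>: "\<A> = insert A \<B>"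
    using A by (auto simp: \<B>_def)
  have IH: "(\<integral>z. (max_avg \<B> z)\<^sup>2 \<partial>gauss \<sigma>) \<le> 2 * (\<integral>z. max_avg \<B> z * max 0 (avg A0 z) \<partial>gauss \<sigma>)"
    using Suc.hyps(2) A(1) Suc.prems by (intro Suc.hyps(1)) (auto simp: \<B>_def)
  define g where "g z = max_avg \<A> z - max_avg \<B> z" for z
  have [measurable]: "g \<in> borel_measurable borel"
    unfolding g_def[abs_def] by measurable
  have g_nonneg: "0 \<le> g z" for z
    by (simp add: g_def \<A> max_avg_insert)
  have g_norm: "\<bar>g z\<bar> \<le> norm z" for z
    using g_nonneg[of z] max_avg_le_norm[of \<A> z] max_avg_nonneg[of \<B> z] unfolding g_def by linarith
  have g_sym: "g (\<chi> k. z $ Transposition.transpose i j k) = g z" if "i \<in> A" "j \<in> A" for i j z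
  proof -
    have "i \<in> B \<and> j \<in> B" if "B \<in> \<A>" for B
      using least[OF that] \<open>i \<in> A\<close> \<open>j \<in> A\<close> by blast
    then show ?thesis
      unfolding g_def by (subst (1 2) max_avg_transpose) (auto simp: \<B>_def)
  qed
  have norms: "\<bar>max_avg \<C> z\<bar> \<le> norm z" "\<bar>avg A0 z\<bar> \<le> norm z" "\<bar>avg A z\<bar> \<le> norm z" "\<bar>max 0 (avg A0 z)\<bar> \<le> norm z"
    for \<C> :: "'n set set" and z :: "real ^ 'n"
    using max_avg_nonneg[of \<C> z] max_avg_le_norm[of \<C> z] abs_avg_le_norm[of A0 z] abs_avg_le_norm[of A z]
    by auto
  note int = integrable_gauss_dominated[OF \<sigma> _ product_le_norm_square]
  have int_sq: "integrable (gauss \<sigma>) (\<lambda>z. (max_avg \<C> z)\<^sup>2)" for \<C> :: "'n set set"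
    unfolding power2_eq_square by (rule int) (use norms in auto)
  have int_gA: "integrable (gauss \<sigma>) (\<lambda>z. g z * avg A z)" "integrable (gauss \<sigma>) (\<lambda>z. g z * avg A0 z)"
    "integrable (gauss \<sigma>) (\<lambda>z. g z * max 0 (avg A0 z))"
    by (rule int; use norms g_norm in auto)+
  have int_M: "integrable (gauss \<sigma>) (\<lambda>z. max_avg \<C> z * max 0 (avg A0 z))" for \<C> :: "'n set set"
    by (rule int) (use norms in auto)
  \<comment> \<open>Either the maximum does not change and g = 0, or it becomes
    \<open>avg A z\<close>, and the claim is that the square of its difference from the old maximum
    is nonnegative.\<close>
  have "(max_avg \<A> z)\<^sup>2 \<le> (max_avg \<B> z)\<^sup>2 + 2 * (g z * avg A z)" for z
  proof (cases "avg A z \<le> max_avg \<B> z")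
    case True
    then show ?thesis by (simp add: g_def \<A> max_avg_insert max_absorb2)
  next
    case False
    then have "max_avg \<A> z = avg A z"
      by (simp add: \<A> max_avg_insert)
    moreover have "0 \<le> (avg A z - max_avg \<B> z)\<^sup>2" by simp
    ultimately show ?thesis
      by (simp add: g_def power2_eq_square algebra_simps)
  qed
  then have "(\<integral>z. (max_avg \<A> z)\<^sup>2 \<partial>gauss \<sigma>) \<le> (\<integral>z. (max_avg \<B> z)\<^sup>2 + 2 * (g z * avg A z) \<partial>gauss \<sigma>)"
    by (intro integral_mono int_sq Bochner_Integration.integrable_add integrable_mult_right int_gA)
  also have "\<dots> = (\<integral>z. (max_avg \<B> z)\<^sup>2 \<partial>gauss \<sigma>) + 2 * (\<integral>z. g z * avg A z \<partial>gauss \<sigma>)"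
    using int_sq int_gA by simp
  also have "(\<integral>z. g z * avg A z \<partial>gauss \<sigma>) = (\<integral>z. g z * avg A0 z \<partial>gauss \<sigma>)"
    using A(1) Suc.prems(1) assms(2) by (intro integral_gauss_symmetric_avg \<sigma> g_norm g_sym) auto
  also have "\<dots> \<le> (\<integral>z. g z * max 0 (avg A0 z) \<partial>gauss \<sigma>)"
    by (intro integral_mono int_gA mult_left_mono g_nonneg) auto
  also have "\<dots> = (\<integral>z. max_avg \<A> z * max 0 (avg A0 z) \<partial>gauss \<sigma>) - (\<integral>z. max_avg \<B> z * max 0 (avg A0 z) \<partial>gauss \<sigma>)"
    using int_M by (simp add: g_def left_diff_distrib)
  finally show ?case
    using IH by simp
qed

text \<open>For distinct coordinates, flipping the sign of one of them shows that the integral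
  equals its own negative.\<close>

lemma integral_gauss_coordinate_product:
  fixes i j :: "'n::finite"
  assumes "0 < \<sigma>"
  shows "(\<integral>z. z $ i * z $ j \<partial>(gauss \<sigma> :: (real ^ 'n) measure)) = (if i = j then \<sigma>\<^sup>2 else 0)"
proof (cases "i = j")
  case True
  then show ?thesis
    using has_bochner_integral_integral_eq[OF has_bochner_integral_gauss_square[OF assms, of j]]
    by (simp add: power2_eq_square)
next
  case False
  define c where "c k = (if k = i then - 1 else 1 :: real)" for k
  have "(\<integral>z. z $ i * z $ j \<partial>(gauss \<sigma> :: (real ^ 'n) measure))
      = (\<integral>z. (\<chi> k. c k * z $ k) $ i * (\<chi> k. c k * z $ k) $ j \<partial>(gauss \<sigma> :: (real ^ 'n) measure))"
    by (rule integral_gauss_signs[symmetric]) (auto simp: c_def)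
  also have "\<dots> = - (\<integral>z. z $ i * z $ j \<partial>(gauss \<sigma> :: (real ^ 'n) measure))"
    using False by (simp add: c_def)
  finally show ?thesis
    using False by simp
qed

lemma integrable_gauss_coordinate_product:
  assumes "0 < \<sigma>"
  shows "integrable (gauss \<sigma> :: (real ^ 'n) measure) (\<lambda>z. z $ i * z $ j)"
  by (rule integrable_gauss_dominated[OF assms _ product_le_norm_square]) (auto simp: component_le_norm_cart)

lemma integral_gauss_avg_square:
  fixes A :: "'n::finite set"
  assumes "0 < \<sigma>" "A \<noteq> {}"
  shows "(\<integral>z. (avg A z)\<^sup>2 \<partial>gauss \<sigma>) = \<sigma>\<^sup>2 / real (card A)"
proof -
  have "(\<integral>z. (avg A z)\<^sup>2 \<partial>gauss \<sigma>) = (\<integral>z. (\<Sum>i\<in>A. \<Sum>j\<in>A. z $ i * z $ j) / (real (card A))\<^sup>2 \<partial>gauss \<sigma>)"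
    by (simp add: avg_def power_divide power2_eq_square sum_product)
  also have "\<dots> = (\<Sum>i\<in>A. \<Sum>j\<in>A. (\<integral>z. z $ i * z $ j \<partial>gauss \<sigma>)) / (real (card A))\<^sup>2"
    by (simp add: integrable_gauss_coordinate_product[OF assms(1)])
  also have "\<dots> = (real (card A) * \<sigma>\<^sup>2) / (real (card A))\<^sup>2"
    by (simp add: integral_gauss_coordinate_product[OF assms(1)])
  finally show ?thesis
    using assms(2) by (simp add: power2_eq_square card_gt_0_iff)
qed

lemma integral_gauss_uminus:
  fixes f :: "real ^ 'n \<Rightarrow> real"
  assumes "f \<in> borel_measurable borel"
  shows "(\<integral>z. f (- z) \<partial>gauss \<sigma>) = (\<integral>z. f z \<partial>gauss \<sigma>)"
proof -
  have "(\<chi> i. - 1 * z $ i) = - z" for z :: "real ^ 'n"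
    by (simp add: vec_eq_iff)
  then show ?thesis
    using integral_gauss_signs[of "\<lambda>_. - 1" f \<sigma>] assms by simp
qed

text \<open>By symmetry under negation, the positive and the negative part each carry half of the
  variance; this lowers the constant 4 in Doob's inequality to 2.\<close>

lemma integral_gauss_pos_avg_square:
  fixes A :: "'n::finite set"
  assumes "0 < \<sigma>" "A \<noteq> {}"
  shows "(\<integral>z. (max 0 (avg A z))\<^sup>2 \<partial>gauss \<sigma>) = \<sigma>\<^sup>2 / (2 * real (card A))"
proof -
  have norms: "\<bar>max 0 (avg A z)\<bar> \<le> norm z" "\<bar>max 0 (- avg A z)\<bar> \<le> norm z" for z
    using abs_avg_le_norm[of A z] by auto
  have int: "integrable (gauss \<sigma>) (\<lambda>z. (max 0 (avg A z))\<^sup>2)" "integrable (gauss \<sigma>) (\<lambda>z. (max 0 (- avg A z))\<^sup>2)"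
    unfolding power2_eq_square
    by (rule integrable_gauss_dominated[OF assms(1) _ product_le_norm_square]; use norms in auto)+
  have "\<sigma>\<^sup>2 / real (card A) = (\<integral>z. (max 0 (avg A z))\<^sup>2 + (max 0 (- avg A z))\<^sup>2 \<partial>gauss \<sigma>)"
    unfolding integral_gauss_avg_square[OF assms, symmetric]
    by (intro Bochner_Integration.integral_cong) (auto simp: max_def)
  also have "\<dots> = (\<integral>z. (max 0 (avg A z))\<^sup>2 \<partial>gauss \<sigma>) + (\<integral>z. (max 0 (- avg A z))\<^sup>2 \<partial>gauss \<sigma>)"
    using int by simp
  also have "(\<integral>z. (max 0 (- avg A z))\<^sup>2 \<partial>gauss \<sigma>) = (\<integral>z. (max 0 (avg A z))\<^sup>2 \<partial>gauss \<sigma>)"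
    using integral_gauss_uminus[of "\<lambda>z. (max 0 (avg A z))\<^sup>2" \<sigma>] by (simp add: avg_uminus)
  finally show ?thesis by simp
qed

lemma integrable_gauss_max_avg_square:
  fixes \<A> :: "'n::finite set set"
  assumes "0 < \<sigma>"
  shows "integrable (gauss \<sigma>) (\<lambda>z. (max_avg \<A> z)\<^sup>2)"
  unfolding power2_eq_square
  by (rule integrable_gauss_dominated[OF assms _ product_le_norm_square]) (auto simp: max_avg_le_norm)

lemma integral_gauss_max_avg_square_le:
  fixes \<A> :: "'n::finite set set"
  assumes \<sigma>: "0 < \<sigma>" and "A0 \<noteq> {}" "\<And>A. A \<in> \<A> \<Longrightarrow> A0 \<subseteq> A"
    and "\<And>A B. A \<in> \<A> \<Longrightarrow> B \<in> \<A> \<Longrightarrow> A \<subseteq> B \<or> B \<subseteq> A"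
  shows "(\<integral>z. (max_avg \<A> z)\<^sup>2 \<partial>gauss \<sigma>) \<le> 2 * \<sigma>\<^sup>2 / real (card A0)"
proof -
  have norms: "\<bar>max 0 (avg A0 z)\<bar> \<le> norm z" "\<bar>max_avg \<A> z\<bar> \<le> norm z" for z
    using abs_avg_le_norm[of A0 z] by (auto simp: max_avg_le_norm)
  note int = integrable_gauss_dominated[OF \<sigma> _ product_le_norm_square]
  have intM: "integrable (gauss \<sigma>) (\<lambda>z. (max_avg \<A> z)\<^sup>2)"
    by (rule integrable_gauss_max_avg_square[OF \<sigma>])
  have inta: "integrable (gauss \<sigma>) (\<lambda>z. (max 0 (avg A0 z))\<^sup>2)"
    unfolding power2_eq_square by (rule int) (use norms in auto)
  have intMa: "integrable (gauss \<sigma>) (\<lambda>z. max_avg \<A> z * max 0 (avg A0 z))"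
    by (rule int) (use norms in auto)
  have "2 * (\<integral>z. max_avg \<A> z * max 0 (avg A0 z) \<partial>gauss \<sigma>) = (\<integral>z. 2 * (max_avg \<A> z * max 0 (avg A0 z)) \<partial>gauss \<sigma>)"
    by simp
  \<comment> \<open>The weights 1/2 and 2 let half of the integral of the squared maximum be
    absorbed on the other side.\<close>
  also have "\<dots> \<le> (\<integral>z. (max_avg \<A> z)\<^sup>2 / 2 + 2 * (max 0 (avg A0 z))\<^sup>2 \<partial>gauss \<sigma>)"
  proof (rule integral_mono)
    fix z
    have "0 \<le> (max_avg \<A> z - 2 * max 0 (avg A0 z))\<^sup>2" by simp
    then show "2 * (max_avg \<A> z * max 0 (avg A0 z)) \<le> (max_avg \<A> z)\<^sup>2 / 2 + 2 * (max 0 (avg A0 z))\<^sup>2"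
      unfolding power2_diff power_mult_distrib by simp
  qed (use intM inta intMa in auto)
  also have "\<dots> = (\<integral>z. (max_avg \<A> z)\<^sup>2 \<partial>gauss \<sigma>) / 2 + 2 * (\<sigma>\<^sup>2 / (2 * real (card A0)))"
    using intM inta by (simp add: integral_gauss_pos_avg_square[OF \<sigma> assms(2)])
  finally have "2 * (\<integral>z. max_avg \<A> z * max 0 (avg A0 z) \<partial>gauss \<sigma>)
      \<le> (\<integral>z. (max_avg \<A> z)\<^sup>2 \<partial>gauss \<sigma>) / 2 + \<sigma>\<^sup>2 / real (card A0)"
    by simp
  moreover have "(\<integral>z. (max_avg \<A> z)\<^sup>2 \<partial>gauss \<sigma>) \<le> 2 * (\<integral>z. max_avg \<A> z * max 0 (avg A0 z) \<partial>gauss \<sigma>)"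
    by (rule integral_gauss_max_avg_square_le_prod) (use assms in auto)
  ultimately show ?thesis by simp
qed

subsection \<open>Block monotone cones\<close>

text \<open>The blocks are the fibres of \<open>\<kappa>\<close>, which may be any subsets of the
  index type; \<open>up\<close> selects the direction on each.\<close>

definition block_monotone :: "('n \<Rightarrow> 'k) \<Rightarrow> ('k \<Rightarrow> bool) \<Rightarrow> (real ^ ('n::{finite,linorder})) set"
  where "block_monotone \<kappa> up =
    {v. \<forall>i j. \<kappa> i = \<kappa> j \<and> i \<le> j \<longrightarrow> (if up (\<kappa> i) then v $ i \<le> v $ j else v $ j \<le> v $ i)}"

text \<open>The superlevel sets of a block monotone vector inside the block of \<open>i\<close> that contain \<open>i\<close>.\<close>

definition tails :: "('n \<Rightarrow> 'k) \<Rightarrow> ('k \<Rightarrow> bool) \<Rightarrow> 'n::{finite,linorder} \<Rightarrow> 'n set set"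
  where "tails \<kappa> up i = (if up (\<kappa> i) then (\<lambda>a. {j. \<kappa> j = \<kappa> i \<and> a \<le> j}) ` {a. \<kappa> a = \<kappa> i \<and> a \<le> i}
    else (\<lambda>b. {j. \<kappa> j = \<kappa> i \<and> j \<le> b}) ` {b. \<kappa> b = \<kappa> i \<and> i \<le> b})"

text \<open>The first term serves the positive part of a block monotone vector v. The second serves
  its negative part: -v is monotone in the opposite directions and is paired with -z.\<close>

definition noise_bound :: "('n \<Rightarrow> 'k) \<Rightarrow> ('k \<Rightarrow> bool) \<Rightarrow> real ^ ('n::{finite,linorder}) \<Rightarrow> real"
  where "noise_bound \<kappa> up z = (\<Sum>i\<in>UNIV. (max_avg (tails \<kappa> up i) z)\<^sup>2
    + (max_avg (tails \<kappa> (\<lambda>k. \<not> up k) i) (- z))\<^sup>2)"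

lemma block_monotoneD:
  assumes "v \<in> block_monotone \<kappa> up" "\<kappa> i = \<kappa> j" "i \<le> j"
  shows "if up (\<kappa> i) then v $ i \<le> v $ j else v $ j \<le> v $ i"
  using assms unfolding block_monotone_def by blast

lemma block_monotone_uminus:
  "v \<in> block_monotone \<kappa> up \<Longrightarrow> - v \<in> block_monotone \<kappa> (\<lambda>k. \<not> up k)"
  by (simp add: block_monotone_def)

lemma block_monotone_scaleR:
  "v \<in> block_monotone \<kappa> up \<Longrightarrow> 0 \<le> c \<Longrightarrow> c *\<^sub>R v \<in> block_monotone \<kappa> up"
  unfolding block_monotone_def by (auto intro!: mult_left_mono split: if_splits)

section \<open>Bounding inner products with block monotone vectors\<close>

text \<open>A nonnegative function is a nonnegative combination of indicators of its superlevel sets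
  at positive levels. The induction splits off the minimal value and removes a minimizer.\<close>

lemma sum_mult_nonpos_of_superlevel:
  fixes v w :: "'i \<Rightarrow> real"
  assumes "finite B" "\<And>i. i \<in> B \<Longrightarrow> 0 \<le> v i"
    and "\<And>t. 0 < t \<Longrightarrow> (\<Sum>i | i \<in> B \<and> t \<le> v i. w i) \<le> 0"
  shows "(\<Sum>i\<in>B. w i * v i) \<le> 0"
  using assms
proof (induction "card B" arbitrary: B v)
  case 0
  then show ?case by simp
next
  case (Suc n)
  then have "B \<noteq> {}" by auto
  then obtain b where b: "b \<in> B" "\<And>i. i \<in> B \<Longrightarrow> v b \<le> v i"
    using ex_is_arg_min_if_finite[OF Suc.prems(1), of v] by (force simp: is_arg_min_linorder)
  have "(\<Sum>i\<in>B - {b}. w i * (v i - v b)) \<le> 0"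
  proof (rule Suc.hyps(1))
    fix t :: real assume "0 < t"
    then have "{i \<in> B - {b}. t \<le> v i - v b} = {i \<in> B. t + v b \<le> v i}"
      by auto
    then show "(\<Sum>i | i \<in> B - {b} \<and> t \<le> v i - v b. w i) \<le> 0"
      using Suc.prems(3)[of "t + v b"] Suc.prems(2)[OF b(1)] \<open>0 < t\<close> by simp
  qed (use Suc.hyps(2) Suc.prems b in auto)
  moreover have "v b * (\<Sum>i\<in>B. w i) \<le> 0"
  proof (cases "v b = 0")
    case False
    then have "0 < v b"
      using Suc.prems(2)[OF b(1)] by simp
    moreover have "{i \<in> B. v b \<le> v i} = B"
      using b by auto
    ultimately show ?thesis
      using Suc.prems(3)[of "v b"] by (simp add: mult_nonneg_nonpos)
  qed simp
  moreover have "(\<Sum>i\<in>B. w i * v i) = v b * (\<Sum>i\<in>B. w i) + (\<Sum>i\<in>B. w i * (v i - v b))"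
    by (simp add: sum_distrib_left right_diff_distrib sum_subtractf mult.commute)
  moreover have "(\<Sum>i\<in>B. w i * (v i - v b)) = (\<Sum>i\<in>B - {b}. w i * (v i - v b))"
    using Suc.prems(1) b(1) by (simp add: sum.remove)
  ultimately show ?case by linarith
qed

text \<open>Monotonicity makes a superlevel set within a block a final or initial segment of it,
  determined by its smallest or largest element.\<close>

lemma superlevel_in_tails:
  assumes v: "v \<in> block_monotone \<kappa> up" and "\<kappa> i = k" "t \<le> v $ i"
  shows "{j. \<kappa> j = k \<and> t \<le> v $ j} \<in> tails \<kappa> up i"
proof -
  let ?C = "{j. \<kappa> j = k \<and> t \<le> v $ j}"
  have i: "i \<in> ?C" and fin: "finite ?C"
    using assms by simp_all
  then have ne: "?C \<noteq> {}"
    by blast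
  show ?thesis
  proof (cases "up k")
    case True
    define a where "a = Min ?C"
    have a: "a \<in> ?C" "\<And>j. j \<in> ?C \<Longrightarrow> a \<le> j"
      using Min_in[OF fin ne] Min_le[OF fin] unfolding a_def by blast+
    have C: "?C = {j. \<kappa> j = \<kappa> i \<and> a \<le> j}"
    proof (intro set_eqI iffI)
      fix j assume j: "j \<in> {j. \<kappa> j = \<kappa> i \<and> a \<le> j}"
      then have "v $ a \<le> v $ j"
        using block_monotoneD[OF v, of a j] True a(1) assms(2) by simp
      then show "j \<in> ?C"
        using a(1) assms(2) j by simp
    qed (use a(2) assms(2) in simp)
    have "a \<in> {a. \<kappa> a = \<kappa> i \<and> a \<le> i}"
      using a(1) a(2)[OF i] assms(2) by simp
    then show ?thesis
      unfolding C tails_def using True assms(2) by simp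
  next
    case False
    define b where "b = Max ?C"
    have b: "b \<in> ?C" "\<And>j. j \<in> ?C \<Longrightarrow> j \<le> b"
      using Max_in[OF fin ne] Max_ge[OF fin] unfolding b_def by blast+
    have C: "?C = {j. \<kappa> j = \<kappa> i \<and> j \<le> b}"
    proof (intro set_eqI iffI)
      fix j assume j: "j \<in> {j. \<kappa> j = \<kappa> i \<and> j \<le> b}"
      then have "v $ b \<le> v $ j"
        using block_monotoneD[OF v, of j b] False b(1) assms(2) by simp
      then show "j \<in> ?C"
        using b(1) assms(2) j by simp
    qed (use b(2) assms(2) in simp)
    have "b \<in> {a. \<kappa> a = \<kappa> i \<and> i \<le> a}"
      using b(1) b(2)[OF i] assms(2) by simp
    then show ?thesis
      unfolding C tails_def using False assms(2) by simp
  qed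
qed

text \<open>It suffices to compare the weights on superlevel sets, block by block. Such a set
  belongs to \<open>tails\<close> of each of its points, so its average is at most every maximum
  involved.\<close>

lemma sum_positive_part_le:
  assumes v: "v \<in> block_monotone \<kappa> up"
  shows "(\<Sum>i\<in>UNIV. z $ i * max 0 (v $ i)) \<le> (\<Sum>i\<in>UNIV. max_avg (tails \<kappa> up i) z * max 0 (v $ i))"
proof -
  let ?w = "\<lambda>i. z $ i - max_avg (tails \<kappa> up i) z"
  have "(\<Sum>i\<in>UNIV. ?w i * max 0 (v $ i)) \<le> 0"
  proof (rule sum_mult_nonpos_of_superlevel)
    fix t :: real assume "0 < t"
    let ?S = "{i. t \<le> v $ i}"
    have "(\<Sum>i\<in>?S. ?w i) = (\<Sum>k\<in>\<kappa> ` ?S. \<Sum>i | i \<in> ?S \<and> \<kappa> i = k. ?w i)"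
      by (rule sum.image_gen) simp
    also have "\<dots> \<le> 0"
    proof (rule sum_nonpos)
      fix k assume "k \<in> \<kappa> ` ?S"
      let ?C = "{j. \<kappa> j = k \<and> t \<le> v $ j}"
      have "?C \<noteq> {}"
        using \<open>k \<in> _\<close> by auto
      \<comment> \<open>Replacing each coordinate by the average over \<open>?C\<close> preserves
        the sum.\<close>
      then have "(\<Sum>i\<in>?C. z $ i) = (\<Sum>i\<in>?C. avg ?C z)"
        by (simp add: avg_def card_gt_0_iff)
      also have "\<dots> \<le> (\<Sum>i\<in>?C. max_avg (tails \<kappa> up i) z)"
        by (intro sum_mono avg_le_max_avg superlevel_in_tails[OF v]) auto
      finally have "(\<Sum>i\<in>?C. ?w i) \<le> 0"
        by (simp add: sum_subtractf)
      moreover have "{i. i \<in> ?S \<and> \<kappa> i = k} = ?C"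
        by auto
      ultimately show "(\<Sum>i | i \<in> ?S \<and> \<kappa> i = k. ?w i) \<le> 0"
        by simp
    qed
    finally show "(\<Sum>i | i \<in> UNIV \<and> t \<le> max 0 (v $ i). ?w i) \<le> 0"
      using \<open>0 < t\<close> by (simp add: le_max_iff_disj)
  qed auto
  then show ?thesis
    by (simp add: left_diff_distrib sum_subtractf)
qed

lemma noise_bound_nonneg [simp]: "0 \<le> noise_bound \<kappa> up z"
  unfolding noise_bound_def by (intro sum_nonneg) auto

text \<open>Split \<open>v\<close> into positive and negative parts, bound each by its maxima of
  averages, and apply Cauchy--Schwarz.\<close>

lemma inner_le_noise_bound:
  assumes v: "v \<in> block_monotone \<kappa> up"
  shows "z \<bullet> v \<le> norm v * sqrt (noise_bound \<kappa> up z)"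
proof -
  let ?p = "\<lambda>i. max_avg (tails \<kappa> up i) z" and ?q = "\<lambda>i. max_avg (tails \<kappa> (\<lambda>k. \<not> up k) i) (- z)"
  have "z \<bullet> v = (\<Sum>i\<in>UNIV. z $ i * max 0 (v $ i)) + (\<Sum>i\<in>UNIV. (- z) $ i * max 0 ((- v) $ i))"
    unfolding inner_vec_def sum.distrib[symmetric] by (intro sum.cong) (auto simp: max_def)
  also have "\<dots> \<le> (\<Sum>i\<in>UNIV. ?p i * max 0 (v $ i)) + (\<Sum>i\<in>UNIV. ?q i * max 0 ((- v) $ i))"
    by (intro add_mono sum_positive_part_le v block_monotone_uminus)
  also have "\<dots> \<le> (\<Sum>i\<in>UNIV. \<bar>v $ i\<bar> * \<bar>sqrt ((?p i)\<^sup>2 + (?q i)\<^sup>2)\<bar>)"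
    unfolding sum.distrib[symmetric]
  proof (rule sum_mono)
    fix i
    \<comment> \<open>At each coordinate at most one of the two parts of \<open>v\<close> is
      nonzero, so bounding \<open>?p i\<close> and \<open>?q i\<close> separately is enough.\<close>
    have "?p i \<le> sqrt ((?p i)\<^sup>2 + (?q i)\<^sup>2)" "?q i \<le> sqrt ((?p i)\<^sup>2 + (?q i)\<^sup>2)"
      by (auto intro: real_le_rsqrt)
    then show "?p i * max 0 (v $ i) + ?q i * max 0 ((- v) $ i) \<le> \<bar>v $ i\<bar> * \<bar>sqrt ((?p i)\<^sup>2 + (?q i)\<^sup>2)\<bar>"
      by (cases "0 \<le> v $ i") (auto simp: max_def mult.commute intro!: mult_left_mono)
  qed
  also have "\<dots> \<le> L2_set (\<lambda>i. v $ i) UNIV * L2_set (\<lambda>i. sqrt ((?p i)\<^sup>2 + (?q i)\<^sup>2)) UNIV"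
    by (rule L2_set_mult_ineq)
  also have "L2_set (\<lambda>i. v $ i) UNIV = norm v"
    by (simp add: norm_vec_def L2_set_def)
  also have "L2_set (\<lambda>i. sqrt ((?p i)\<^sup>2 + (?q i)\<^sup>2)) UNIV = sqrt (noise_bound \<kappa> up z)"
    by (simp add: L2_set_def noise_bound_def)
  finally show ?thesis .
qed

section \<open>Expectation of the noise bound\<close>

text \<open>Listed from the largest element of \<open>B\<close> down, the cardinalities are 1, 2,
  ..., card B.\<close>

lemma sum_inverse_upper_card:
  fixes B :: "'n::linorder set"
  assumes "finite B"
  shows "(\<Sum>i\<in>B. 1 / real (card {j \<in> B. i \<le> j})) = harm (card B)"
  using assms
proof (induction rule: finite_linorder_min_induct)
  case (insert b B)
  have "b \<notin> B"
    using insert.hyps by auto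
  have "{j \<in> insert b B. b \<le> j} = insert b B"
    using insert.hyps by auto
  moreover have "{j \<in> insert b B. i \<le> j} = {j \<in> B. i \<le> j}" if "i \<in> B" for i
    using insert.hyps that by auto
  ultimately show ?case
    using insert \<open>b \<notin> B\<close> by (simp add: harm_Suc inverse_eq_divide)
qed (simp add: harm_def)

lemma sum_inverse_lower_card:
  fixes B :: "'n::linorder set"
  assumes "finite B"
  shows "(\<Sum>i\<in>B. 1 / real (card {j \<in> B. j \<le> i})) = harm (card B)"
  using assms
proof (induction rule: finite_linorder_max_induct)
  case (insert b B)
  have "b \<notin> B"
    using insert.hyps by auto
  have "{j \<in> insert b B. j \<le> b} = insert b B"
    using insert.hyps by auto
  moreover have "{j \<in> insert b B. j \<le> i} = {j \<in> B. j \<le> i}" if "i \<in> B" for i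
    using insert.hyps that by auto
  ultimately show ?case
    using insert \<open>b \<notin> B\<close> by (simp add: harm_Suc inverse_eq_divide)
qed (simp add: harm_def)

lemma harm_le_ln:
  assumes "0 < n"
  shows "harm n \<le> 1 + ln (real n)"
proof -
  obtain k where "n = Suc k"
    using assms by (cases n) auto
  then show ?thesis
    using decseq_harm_diff_ln[THEN decseqD, of 0 k] by (simp add: harm_def)
qed

text \<open>The members of \<open>tails\<close> are nested, and the smallest is the part of the
  block cut off at i itself; Doob's bound is applied with this set as \<open>A0\<close>.\<close>

lemma integral_tails_le:
  fixes \<kappa> :: "'n::{finite,linorder} \<Rightarrow> 'k"
  assumes "0 < \<sigma>"
  shows "(\<integral>z. (max_avg (tails \<kappa> up i) z)\<^sup>2 \<partial>gauss \<sigma>)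
    \<le> 2 * \<sigma>\<^sup>2 / real (card (if up (\<kappa> i) then {j. \<kappa> j = \<kappa> i \<and> i \<le> j} else {j. \<kappa> j = \<kappa> i \<and> j \<le> i}))"
proof (rule integral_gauss_max_avg_square_le[OF assms])
  fix A B assume "A \<in> tails \<kappa> up i" "B \<in> tails \<kappa> up i"
  then obtain a b where *: "A = (if up (\<kappa> i) then {j. \<kappa> j = \<kappa> i \<and> a \<le> j} else {j. \<kappa> j = \<kappa> i \<and> j \<le> a})"
    "B = (if up (\<kappa> i) then {j. \<kappa> j = \<kappa> i \<and> b \<le> j} else {j. \<kappa> j = \<kappa> i \<and> j \<le> b})"
    by (auto simp: tails_def split: if_splits)
  have "a \<le> b \<or> b \<le> a"
    by (rule linear)
  then show "A \<subseteq> B \<or> B \<subseteq> A"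
    unfolding * by (auto intro: order_trans)
qed (auto simp: tails_def split: if_splits)

text \<open>The terms for z and for -z have opposite directions, so each coordinate contributes one
  upper and one lower cardinality. Each block gives two harmonic sums, and with the factor 2
  \<sigma>^2 from Doob this makes 4 \<sigma>^2 (1 + ln n).\<close>

lemma integral_noise_bound_le:
  fixes \<kappa> :: "'n::{finite,linorder} \<Rightarrow> 'k"
  assumes \<sigma>: "0 < \<sigma>"
  shows "integrable (gauss \<sigma>) (noise_bound \<kappa> up)"
    and "(\<integral>z. noise_bound \<kappa> up z \<partial>gauss \<sigma>) \<le> \<sigma>\<^sup>2 * (4 * real (card (range \<kappa>)) * (1 + ln (real CARD('n))))"
proof -
  let ?p = "\<lambda>i z. (max_avg (tails \<kappa> up i) z)\<^sup>2" and ?q = "\<lambda>i z. (max_avg (tails \<kappa> (\<lambda>k. \<not> up k) i) z)\<^sup>2"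
  let ?U = "\<lambda>i. {j. \<kappa> j = \<kappa> i \<and> i \<le> j}" and ?L = "\<lambda>i. {j. \<kappa> j = \<kappa> i \<and> j \<le> i}"
  have intp: "integrable (gauss \<sigma>) (?p i)" for i
    by (rule integrable_gauss_max_avg_square[OF \<sigma>])
  have intq: "integrable (gauss \<sigma>) (\<lambda>z. ?q i (- z))" for i
    unfolding power2_eq_square
    by (rule integrable_gauss_dominated[OF \<sigma> _ product_le_norm_square])
       (use max_avg_le_norm[of _ "- _"] in auto)
  show "integrable (gauss \<sigma>) (noise_bound \<kappa> up)"
    unfolding noise_bound_def[abs_def] using intp intq by simp
  have "(\<integral>z. noise_bound \<kappa> up z \<partial>gauss \<sigma>) = (\<Sum>i\<in>UNIV. (\<integral>z. ?p i z \<partial>gauss \<sigma>) + (\<integral>z. ?q i (- z) \<partial>gauss \<sigma>))"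
    unfolding noise_bound_def using intp intq by simp
  also have "\<dots> \<le> (\<Sum>i\<in>UNIV. 2 * \<sigma>\<^sup>2 * (1 / real (card (?U i)) + 1 / real (card (?L i))))"
  proof (rule sum_mono)
    fix i
    have "(\<integral>z. ?q i (- z) \<partial>gauss \<sigma>) = (\<integral>z. ?q i z \<partial>gauss \<sigma>)"
      by (rule integral_gauss_uminus) measurable
    then show "(\<integral>z. ?p i z \<partial>gauss \<sigma>) + (\<integral>z. ?q i (- z) \<partial>gauss \<sigma>)
        \<le> 2 * \<sigma>\<^sup>2 * (1 / real (card (?U i)) + 1 / real (card (?L i)))"
      using integral_tails_le[OF \<sigma>, of \<kappa> up i] integral_tails_le[OF \<sigma>, of \<kappa> "\<lambda>k. \<not> up k" i]
      by (cases "up (\<kappa> i)") (simp_all add: distrib_left)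
  qed
  also have "\<dots> = 2 * \<sigma>\<^sup>2 * (\<Sum>i\<in>UNIV. 1 / real (card (?U i)) + 1 / real (card (?L i)))"
    by (simp only: sum_distrib_left)
  also have "\<dots> \<le> 2 * \<sigma>\<^sup>2 * (\<Sum>k\<in>range \<kappa>. 2 * (1 + ln (real CARD('n))))"
  proof (rule mult_left_mono)
  have "(\<Sum>i\<in>UNIV. 1 / real (card (?U i)) + 1 / real (card (?L i)))
      = (\<Sum>k\<in>range \<kappa>. \<Sum>i | i \<in> UNIV \<and> \<kappa> i = k. 1 / real (card (?U i)) + 1 / real (card (?L i)))"
    by (rule sum.image_gen) simp
  also have "\<dots> \<le> (\<Sum>k\<in>range \<kappa>. 2 * (1 + ln (real CARD('n))))"
  proof (rule sum_mono)
    fix k assume "k \<in> range \<kappa>"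
    let ?B = "{i. \<kappa> i = k}"
    have "(\<Sum>i | i \<in> UNIV \<and> \<kappa> i = k. 1 / real (card (?U i)) + 1 / real (card (?L i)))
        = (\<Sum>i\<in>?B. 1 / real (card {j \<in> ?B. i \<le> j}) + 1 / real (card {j \<in> ?B. j \<le> i}))"
      by (intro sum.cong) auto
    also have "\<dots> = 2 * harm (card ?B)"
      by (simp add: sum.distrib sum_inverse_upper_card[of ?B, simplified] sum_inverse_lower_card[of ?B, simplified])
    also have "\<dots> \<le> 2 * (1 + ln (real CARD('n)))"
    proof -
      have "0 < card ?B"
        using \<open>k \<in> _\<close> by (auto simp: card_gt_0_iff)
      moreover have "card ?B \<le> CARD('n)"
        by (intro card_mono) auto
      ultimately have "ln (real (card ?B)) \<le> ln (real CARD('n))"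
        by (intro ln_mono) auto
      then show ?thesis
        using harm_le_ln[OF \<open>0 < card ?B\<close>] by simp
    qed
    finally show "(\<Sum>i | i \<in> UNIV \<and> \<kappa> i = k. 1 / real (card (?U i)) + 1 / real (card (?L i)))
        \<le> 2 * (1 + ln (real CARD('n)))" .
  qed
  finally show "(\<Sum>i\<in>UNIV. 1 / real (card (?U i)) + 1 / real (card (?L i)))
      \<le> (\<Sum>k\<in>range \<kappa>. 2 * (1 + ln (real CARD('n))))" .
  qed simp
  finally show "(\<integral>z. noise_bound \<kappa> up z \<partial>gauss \<sigma>) \<le> \<sigma>\<^sup>2 * (4 * real (card (range \<kappa>)) * (1 + ln (real CARD('n))))"
    by (simp add: algebra_simps)
qed

section \<open>Support functions of cones\<close>

text \<open>This is the support function of the part of \<open>K\<close> in the unit ball. The ball,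
  unlike the sphere, contains 0, so the value is nonnegative as soon as \<open>K\<close> contains
  0.\<close>

definition cone_sup :: "(real ^ 'n) set \<Rightarrow> real ^ 'n \<Rightarrow> real"
  where "cone_sup K z = (SUP v\<in>{v \<in> K. norm v \<le> 1}. z \<bullet> v)"

lemma bdd_above_cone_sup: "bdd_above ((\<lambda>v. z \<bullet> v) ` {v \<in> K. norm v \<le> 1})"
proof (rule bdd_aboveI2)
  fix v assume "v \<in> {v \<in> K. norm v \<le> 1}"
  then show "z \<bullet> v \<le> norm z"
    using norm_cauchy_schwarz[of z v] mult_left_le[of "norm v" "norm z"] by simp
qed

lemma cone_sup_upper: "v \<in> K \<Longrightarrow> norm v \<le> 1 \<Longrightarrow> z \<bullet> v \<le> cone_sup K z"
  unfolding cone_sup_def by (rule cSUP_upper[OF _ bdd_above_cone_sup]) simp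

lemma cone_sup_least:
  assumes "0 \<in> K" "\<And>v. v \<in> K \<Longrightarrow> norm v \<le> 1 \<Longrightarrow> z \<bullet> v \<le> c"
  shows "cone_sup K z \<le> c"
  unfolding cone_sup_def using assms by (intro cSUP_least) auto

lemma cone_sup_nonneg: "0 \<in> K \<Longrightarrow> 0 \<le> cone_sup K z"
  using cone_sup_upper[of 0 K z] by simp

lemma cone_sup_lipschitz:
  assumes "0 \<in> K"
  shows "cone_sup K x \<le> cone_sup K y + norm (x - y)"
proof (rule cone_sup_least[OF assms])
  fix v assume v: "v \<in> K" "norm v \<le> 1"
  have "x \<bullet> v = y \<bullet> v + (x - y) \<bullet> v"
    by (simp add: inner_diff_left)
  also have "(x - y) \<bullet> v \<le> norm (x - y)"
    using norm_cauchy_schwarz[of "x - y" v] mult_left_le[of "norm v" "norm (x - y)"] v by simp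
  finally show "x \<bullet> v \<le> cone_sup K y + norm (x - y)"
    using cone_sup_upper[OF v, of y] by simp
qed

text \<open>The supremum may range over an uncountable set, so measurability is obtained from
  Lipschitz continuity.\<close>

lemma cone_sup_measurable:
  assumes "0 \<in> K"
  shows "cone_sup K \<in> borel_measurable borel"
proof -
  have "1-lipschitz_on UNIV (cone_sup K)"
  proof (rule lipschitz_onI)
    fix x y
    show "dist (cone_sup K x) (cone_sup K y) \<le> 1 * dist x y"
      using cone_sup_lipschitz[OF assms, of x y] cone_sup_lipschitz[OF assms, of y x]
      by (simp add: dist_norm abs_le_iff norm_minus_commute)
  qed simp
  then show ?thesis
    by (intro borel_measurable_continuous_onI lipschitz_on_continuous_on)
qed

lemma inner_le_cone_sup:
  assumes "0 \<in> K" "v \<in> K" "\<And>c. 0 \<le> c \<Longrightarrow> c *\<^sub>R v \<in> K"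
  shows "z \<bullet> v \<le> norm v * cone_sup K z"
proof (cases "v = 0")
  case False
  have "z \<bullet> (inverse (norm v) *\<^sub>R v) \<le> cone_sup K z"
    using False assms by (intro cone_sup_upper) auto
  then show ?thesis
    using False by (simp add: field_simps)
qed simp

text \<open>Concentration is applied to the 1-Lipschitz support function, whose square is dominated
  by \<open>noise_bound\<close>; the factor 4 in its expectation becomes 1/2 through the exponent D
  / 8.\<close>

lemma block_monotone_concentration:
  fixes \<kappa> :: "'n::{finite,linorder} \<Rightarrow> 'k"
  assumes \<sigma>: "0 < \<sigma>"
  shows "measure (gauss \<sigma>) {z. t < (cone_sup (block_monotone \<kappa> up) z)\<^sup>2}
    \<le> exp (real (card (range \<kappa>)) * (1 + ln (real CARD('n))) / 2 - t / (12 * \<sigma>\<^sup>2))"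
proof -
  let ?F = "cone_sup (block_monotone \<kappa> up)"
  have 0: "0 \<in> block_monotone \<kappa> up"
    by (simp add: block_monotone_def)
  note [measurable] = cone_sup_measurable[OF 0]
  have le: "(?F z)\<^sup>2 \<le> noise_bound \<kappa> up z" for z
  proof -
    have "?F z \<le> sqrt (noise_bound \<kappa> up z)"
    proof (rule cone_sup_least[OF 0])
      fix v assume "v \<in> block_monotone \<kappa> up" "norm v \<le> 1"
      then show "z \<bullet> v \<le> sqrt (noise_bound \<kappa> up z)"
        using inner_le_noise_bound[of v \<kappa> up z] mult_right_mono[of "norm v" 1 "sqrt (noise_bound \<kappa> up z)"]
        by simp
    qed
    then have "(?F z)\<^sup>2 \<le> (sqrt (noise_bound \<kappa> up z))\<^sup>2"
      by (intro power_mono cone_sup_nonneg 0)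
    then show ?thesis by simp
  qed
  have int: "integrable (gauss \<sigma>) (\<lambda>z. (?F z)\<^sup>2)"
    by (rule Bochner_Integration.integrable_bound[OF integral_noise_bound_le(1)[OF \<sigma>, of \<kappa> up]])
       (use le in auto)
  have "(\<integral>z. (?F z)\<^sup>2 \<partial>gauss \<sigma>) \<le> (\<integral>z. noise_bound \<kappa> up z \<partial>gauss \<sigma>)"
    by (intro integral_mono int integral_noise_bound_le(1) \<sigma> le)
  also have "\<dots> \<le> \<sigma>\<^sup>2 * (4 * real (card (range \<kappa>)) * (1 + ln (real CARD('n))))"
    by (rule integral_noise_bound_le(2)[OF \<sigma>])
  finally have "measure (gauss \<sigma>) {z. t < (?F z)\<^sup>2}
      \<le> exp (4 * real (card (range \<kappa>)) * (1 + ln (real CARD('n))) / 8 - t / (12 * \<sigma>\<^sup>2))"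
    by (intro gauss_concentration \<sigma> int cone_sup_nonneg cone_sup_lipschitz 0) measurable
  then show ?thesis by simp
qed

subsection \<open>Unimodal regression\<close>

text \<open>On each block \<theta>' is constant and all indices lie on one side of m, so the
  difference inherits the direction of \<theta>. The entry \<open>i \<le> m'\<close> separates equal
  values on the two sides of m'; if m' is a mode of \<theta>', this makes the constancy blocks
  intervals, as the counting of blocks requires.\<close>

lemma mode_cone_diff_block_monotone:
  assumes "\<theta> \<in> mode_cone m"
  shows "\<theta> - \<theta>' \<in> block_monotone (\<lambda>i. (\<theta>' $ i, i \<le> m', i \<le> m)) (\<lambda>k. snd (snd k))"
proof -
  have "if i \<le> m then \<theta> $ i \<le> \<theta> $ j else \<theta> $ j \<le> \<theta> $ i" if "i \<le> m \<longleftrightarrow> j \<le> m" "i \<le> j" for i j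
    using assms that unfolding mode_cone_def
    by (cases "i \<le> m") (auto dest!: monotone_onD[of _ _ _ _ i j])
  then show ?thesis
    unfolding block_monotone_def by simp
qed

text \<open>Cutting at \<open>m\<close> splits at most one of the constancy blocks of \<open>\<theta>\<close>.\<close>

lemma card_blocks_le:
  fixes \<theta> :: "real ^ ('n::{finite,linorder})"
  assumes "\<theta> \<in> mode_cone m'"
  shows "card (range (\<lambda>i. (\<theta> $ i, i \<le> m', i \<le> m)))
    \<le> card ((\<lambda>i. \<theta> $ i) ` {..m'}) + card ((\<lambda>i. \<theta> $ i) ` {m'<..}) + 1"
proof -
  \<comment> \<open>\<open>?X\<close> is the label of the part beyond m of the block containing m.
    Apart from it, the first two components determine a label.\<close>
  let ?\<kappa> = "\<lambda>i. (\<theta> $ i, i \<le> m', i \<le> m)" and ?X = "(\<theta> $ m, m \<le> m', False)"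
  let ?R = "range (\<lambda>i. (\<theta> $ i, i \<le> m'))"
  have mono: "\<theta> $ i \<le> \<theta> $ j" if "i \<le> j" "j \<le> m'" for i j
    using assms that unfolding mode_cone_def by (auto dest!: monotone_onD[of _ _ _ _ i j])
  have antimono: "\<theta> $ j \<le> \<theta> $ i" if "i \<le> j" "m' \<le> i" for i j
    using assms that unfolding mode_cone_def by (auto dest!: monotone_onD[of _ _ _ _ i j])
  \<comment> \<open>A block with elements on both sides of the cut contains m, because \<theta> is
    monotone on either side of m'.\<close>
  have split: "\<theta> $ i = \<theta> $ m \<and> (i \<le> m' \<longleftrightarrow> m \<le> m')"
    if "i \<le> m" "\<not> j \<le> m" "\<theta> $ i = \<theta> $ j" "i \<le> m' \<longleftrightarrow> j \<le> m'" for i j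
  proof (cases "i \<le> m'")
    case True
    then have "\<theta> $ i \<le> \<theta> $ m" "\<theta> $ m \<le> \<theta> $ j"
      using that mono[of i m] mono[of m j] by auto
    then show ?thesis
      using True that by auto
  next
    case False
    then have "\<theta> $ j \<le> \<theta> $ m" "\<theta> $ m \<le> \<theta> $ i"
      using that antimono[of i m] antimono[of m j] by auto
    then show ?thesis
      using False that by auto
  qed
  have "inj_on (\<lambda>(c, p, q). (c, p)) (range ?\<kappa> - {?X})"
  proof (rule inj_onI)
    fix u v assume u: "u \<in> range ?\<kappa> - {?X}" and v: "v \<in> range ?\<kappa> - {?X}"
      and eq: "(\<lambda>(c, p, q). (c, p)) u = (\<lambda>(c, p, q). (c, p)) v"
    from u v obtain i j where ij: "u = ?\<kappa> i" "v = ?\<kappa> j"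
      by blast
    have "i \<le> m \<longleftrightarrow> j \<le> m"
    proof (rule ccontr)
      assume "\<not> (i \<le> m \<longleftrightarrow> j \<le> m)"
      then consider "i \<le> m" "\<not> j \<le> m" | "j \<le> m" "\<not> i \<le> m"
        by blast
      then show False
      proof cases
        case 1
        then have "v = ?X"
          using split[of i j] eq ij by simp
        then show False
          using v by blast
      next
        case 2
        then have "u = ?X"
          using split[of j i] eq ij by simp
        then show False
          using u by blast
      qed
    qed
    then show "u = v"
      using eq ij by simp
  qed
  then have "card (range ?\<kappa> - {?X}) \<le> card ?R"
    by (rule card_inj_on_le) auto
  moreover have "card (range ?\<kappa>) \<le> card (range ?\<kappa> - {?X}) + 1"
    using card_Diff1_le[of "range ?\<kappa>" ?X] card_Suc_Diff1[of "range ?\<kappa>" ?X]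
    by (cases "?X \<in> range ?\<kappa>") auto
  moreover have "card ?R \<le> card ((\<lambda>i. \<theta> $ i) ` {..m'}) + card ((\<lambda>i. \<theta> $ i) ` {m'<..})"
  proof -
    have "?R \<subseteq> (\<lambda>c. (c, True)) ` (\<lambda>i. \<theta> $ i) ` {..m'} \<union> (\<lambda>c. (c, False)) ` (\<lambda>i. \<theta> $ i) ` {m'<..}"
    proof clarify
      fix i assume "(\<theta> $ i, i \<le> m') \<notin> (\<lambda>c. (c, False)) ` (\<lambda>i. \<theta> $ i) ` {m'<..}"
      then show "(\<theta> $ i, i \<le> m') \<in> (\<lambda>c. (c, True)) ` (\<lambda>i. \<theta> $ i) ` {..m'}"
        by (cases "i \<le> m'") auto
    qed
    then have "card ?R \<le> card ((\<lambda>c. (c, True)) ` (\<lambda>i. \<theta> $ i) ` {..m'} \<union> (\<lambda>c. (c, False)) ` (\<lambda>i. \<theta> $ i) ` {m'<..})"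
      by (intro card_mono) auto
    also have "\<dots> \<le> card ((\<lambda>c. (c, True)) ` (\<lambda>i. \<theta> $ i) ` {..m'}) + card ((\<lambda>c. (c, False)) ` (\<lambda>i. \<theta> $ i) ` {m'<..})"
      by (rule card_Un_le)
    also have "\<dots> \<le> card ((\<lambda>i. \<theta> $ i) ` {..m'}) + card ((\<lambda>i. \<theta> $ i) ` {m'<..})"
      by (intro add_mono card_image_le) auto
    finally show ?thesis .
  qed
  ultimately show ?thesis by linarith
qed

text \<open>The first hypothesis is minimality tested against \<theta>0. Expanding the square gives
  |d|^2 \<le> 2 (z . d) \<le> 2 |d| c for the error d, and a factor |d| cancels.\<close>

lemma least_squares_error_le:
  fixes \<theta>0 \<theta> z :: "real ^ 'n"
  assumes "(norm (\<theta>0 + z - \<theta>))\<^sup>2 \<le> (norm z)\<^sup>2" and "z \<bullet> (\<theta> - \<theta>0) \<le> norm (\<theta> - \<theta>0) * c" "0 \<le> c"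
  shows "(norm (\<theta> - \<theta>0))\<^sup>2 \<le> 4 * c\<^sup>2"
proof -
  let ?d = "\<theta> - \<theta>0"
  have "\<theta>0 + z - \<theta> = z - ?d" by simp
  then have "(norm (z - ?d))\<^sup>2 \<le> (norm z)\<^sup>2"
    using assms(1) by (simp only:)
  then have "(norm ?d)\<^sup>2 \<le> 2 * (z \<bullet> ?d)"
    unfolding dot_norm_neg[of z ?d] by argo
  then have "norm ?d * norm ?d \<le> norm ?d * (2 * c)"
    using assms(2) by (simp add: power2_eq_square)
  then have "norm ?d \<le> 2 * c"
    using assms(3) mult_left_le_imp_le[of "norm ?d" "norm ?d" "2 * c"] by (cases "norm ?d = 0") auto
  then have "(norm ?d)\<^sup>2 \<le> (2 * c)\<^sup>2"
    by (intro power_mono) auto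
  then show ?thesis by (simp add: power_mult_distrib)
qed

text \<open>The left side is four times the tail threshold of the final proof. The slack is written
  as nonnegative products plus a remainder, which is controlled by ln n \<ge> 1/2 and ln 4 \<ge>
  1.\<close>

lemma risk_threshold_le:
  fixes n s :: nat and \<alpha> \<sigma> :: real
  assumes "2 \<le> n" "1 \<le> s" "s \<le> n" "0 < \<alpha>"
  shows "4 * (12 * \<sigma>\<^sup>2 * ((1 + \<alpha>) * ln (real n) - ln 4 + real (s + 1) * (1 + ln (real n)) / 2))
    \<le> 12 * \<sigma>\<^sup>2 * real s * ln (exp 1 * real n / real s) + 48 * (\<alpha> + 2) * \<sigma>\<^sup>2 * real s * ln (real n)"
proof -
  define L where "L = ln (real n)"
  define l where "l = ln (real s)"
  have "1 \<le> real s"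
    using assms(2) by simp
  have ln4: "1 \<le> ln (4 :: real)"
    using exp_le by (subst ln_ge_iff) auto
  have "ln (4 :: real) = 2 * ln 2"
    using ln_powr[of 2 2] ln_realpow[of 2 2] by simp
  moreover have "ln 2 \<le> L"
    unfolding L_def using assms by (intro ln_mono) auto
  ultimately have L: "1 / 2 \<le> L"
    using ln4 by simp
  have l: "0 \<le> l" "l \<le> L"
    using assms by (auto simp: l_def L_def intro!: ln_mono)
  have e: "ln (exp 1 * real n / real s) = 1 + L - l"
    using assms by (simp add: ln_div ln_mult L_def l_def)
  have "0 \<le> real s * (L - l)" "0 \<le> \<alpha> * ((real s - 1) * L)"
    using l L assms by auto
  moreover have "real s - 1 \<le> 2 * ((real s - 1) * L)"
    using mult_left_mono[OF L, of "real s - 1"] \<open>1 \<le> real s\<close> by simp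
  moreover have "A \<le> B" if "0 \<le> P" "0 \<le> Q" "real s - 1 \<le> 2 * R"
    "B - A = 12 * P + 48 * Q + 72 * R - 12 * real s - 24 + 48 * ln 4" for A B P Q R :: real
    using that ln4 \<open>1 \<le> real s\<close> by argo
  moreover have "12 * real s * (1 + L - l) + 48 * (\<alpha> + 2) * real s * L
      - 4 * (12 * ((1 + \<alpha>) * L - ln 4 + real (s + 1) * (1 + L) / 2))
    = 12 * (real s * (L - l)) + 48 * (\<alpha> * ((real s - 1) * L)) + 72 * ((real s - 1) * L) - 12 * real s - 24 + 48 * ln 4"
    by (simp add: field_simps)
  ultimately have "4 * (12 * ((1 + \<alpha>) * L - ln 4 + real (s + 1) * (1 + L) / 2))
      \<le> 12 * real s * (1 + L - l) + 48 * (\<alpha> + 2) * real s * L"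
    by blast
  then have "\<sigma>\<^sup>2 * (4 * (12 * ((1 + \<alpha>) * L - ln 4 + real (s + 1) * (1 + L) / 2)))
      \<le> \<sigma>\<^sup>2 * (12 * real s * (1 + L - l) + 48 * (\<alpha> + 2) * real s * L)"
    by (rule mult_left_mono) simp
  then show ?thesis
    unfolding e L_def[symmetric] by (simp add: algebra_simps)
qed

theorem theorem2p2:
  fixes M :: "'a measure"
    and Z \<theta>hat :: "'a \<Rightarrow> real ^ ('n::{finite,linorder})"
    and \<theta>star :: "real ^ ('n::{finite,linorder})"
    and mstar :: "'n::{finite,linorder}"
    and \<sigma> \<alpha> :: real
    and n s\<^sub>1 s\<^sub>2 :: nat
  assumes "n = CARD('n)"
    and "s\<^sub>1 = card ((\<lambda>i. \<theta>star $ i) ` {..mstar})"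
    and "s\<^sub>2 = card ((\<lambda>i. \<theta>star $ i) ` {mstar<..})"
    and "prob_space M"
    and "\<sigma> > 0"
    and "distributed M lborel Z (isotropic_normal_density \<sigma>)"
    and "\<theta>star \<in> unimodal"
    and "\<theta>star \<in> mode_cone mstar"
    and "\<And>\<omega>. \<omega> \<in> space M \<Longrightarrow>
      is_arg_min (\<lambda>\<theta>. (norm (\<theta>star + Z \<omega> - \<theta>))\<^sup>2) (\<lambda>\<theta>. \<theta> \<in> unimodal) (\<theta>hat \<omega>)"
    and "\<alpha> > 0"
  shows "\<exists>E\<in>sets M. measure M E \<ge> 1 - 4 / real n powr \<alpha> \<and>
    (\<forall>\<omega>\<in>E. 1 / real n * (norm (\<theta>hat \<omega> - \<theta>star))\<^sup>2
      \<le> 12 * \<sigma>\<^sup>2 * (real (s\<^sub>1 + s\<^sub>2) / real n) * ln (exp 1 * real n / real (s\<^sub>1 + s\<^sub>2))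
        + 48 * (\<alpha> + 2) * \<sigma>\<^sup>2 * real (s\<^sub>1 + s\<^sub>2) * (ln (real n) / real n))"
proof (cases "2 \<le> n")
  case False
  then have "n = 1"
    using assms(1) zero_less_card_finite[where 'a='n] by linarith
  \<comment> \<open>For n = 1 the required probability is 1 - 4 < 0, so the empty event
    suffices.\<close>
  then show ?thesis
    by (intro bexI[of _ "{}"]) auto
next
  case True
  interpret prob_space M by fact
  define s where "s = s\<^sub>1 + s\<^sub>2"
  define K where "K m = block_monotone (\<lambda>i. (\<theta>star $ i, i \<le> mstar, i \<le> m)) (\<lambda>k. snd (snd k))" for m
  \<comment> \<open>With at most s + 1 blocks, this threshold makes the tail for one mode at most 4
    / n^(1 + \<alpha>), so that the union bound over n modes leaves 4 / n^\<alpha>.\<close>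
  define t where "t = 12 * \<sigma>\<^sup>2 * ((1 + \<alpha>) * ln (real n) - ln 4 + real (s + 1) * (1 + ln (real n)) / 2)"
  \<comment> \<open>The event concerns the noise alone and covers all modes at once, because the
    mode of the estimator is random and the choice among minimizers is arbitrary.\<close>
  define E where "E = {\<omega> \<in> space M. \<forall>m. (cone_sup (K m) (Z \<omega>))\<^sup>2 \<le> t}"
  have s: "1 \<le> s" "s \<le> n"
  proof -
    have "0 < s\<^sub>1"
      unfolding assms(2) by (auto simp: card_gt_0_iff)
    then show "1 \<le> s" by (simp add: s_def)
    have "s\<^sub>1 \<le> card {..mstar}" "s\<^sub>2 \<le> card {mstar<..}"
      unfolding assms(2,3) by (auto intro: card_image_le)
    moreover have "card ({..mstar} \<union> {mstar<..}) = card {..mstar} + card {mstar<..}"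
      by (rule card_Un_disjoint) auto
    moreover have "{..mstar} \<union> {mstar<..} = UNIV" by auto
    ultimately show "s \<le> n" by (simp add: s_def assms(1))
  qed
  have K0: "0 \<in> K m" for m
    by (simp add: K_def block_monotone_def)
  note [measurable] = cone_sup_measurable[OF K0]
  have Z [measurable]: "Z \<in> M \<rightarrow>\<^sub>M borel"
    using distributed_measurable[OF assms(6)] by simp
  have Zdistr: "distr M borel Z = gauss \<sigma>"
  proof -
    have "distr M borel Z = distr M lborel Z"
      by (rule distr_cong) auto
    also have "\<dots> = gauss \<sigma>"
      using distributed_distr_eq_density[OF assms(6)] by (simp add: gauss_def)
    finally show ?thesis .
  qed
  have [measurable]: "E \<in> sets M"
    unfolding E_def by measurable
  have tail: "prob {\<omega> \<in> space M. t < (cone_sup (K m) (Z \<omega>))\<^sup>2} \<le> 4 / real n powr (1 + \<alpha>)" for m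
  proof -
    have "prob {\<omega> \<in> space M. t < (cone_sup (K m) (Z \<omega>))\<^sup>2} = measure (distr M borel Z) {z. t < (cone_sup (K m) z)\<^sup>2}"
      by (subst measure_distr) (auto intro!: arg_cong[where f=prob])
    also have "\<dots> \<le> exp (real (card (range (\<lambda>i. (\<theta>star $ i, i \<le> mstar, i \<le> m)))) * (1 + ln (real n)) / 2 - t / (12 * \<sigma>\<^sup>2))"
      unfolding Zdistr K_def assms(1) by (rule block_monotone_concentration[OF assms(5)])
    also have "\<dots> \<le> exp (real (s + 1) * (1 + ln (real n)) / 2 - t / (12 * \<sigma>\<^sup>2))"
    proof -
      have "real (card (range (\<lambda>i. (\<theta>star $ i, i \<le> mstar, i \<le> m)))) \<le> real (s + 1)"
        using card_blocks_le[OF assms(8), of m] by (simp add: s_def assms(2,3))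
      moreover have "0 \<le> 1 + ln (real n)"
        using True by simp
      ultimately show ?thesis
        by (simp add: mult_right_mono)
    qed
    also have "\<dots> = exp (ln 4 - (1 + \<alpha>) * ln (real n))"
      using assms(5) by (simp add: t_def)
    also have "\<dots> = 4 / real n powr (1 + \<alpha>)"
      using True by (simp add: exp_diff powr_def)
    finally show ?thesis .
  qed
  have "1 - 4 / real n powr \<alpha> \<le> prob E"
  proof -
    have "space M - E = (\<Union>m\<in>UNIV. {\<omega> \<in> space M. t < (cone_sup (K m) (Z \<omega>))\<^sup>2})"
      by (auto simp: E_def simp flip: not_le)
    then have "prob (space M - E) \<le> (\<Sum>m\<in>UNIV. prob {\<omega> \<in> space M. t < (cone_sup (K m) (Z \<omega>))\<^sup>2})"
      by (simp only:) (rule finite_measure_subadditive_finite, simp, intro image_subsetI, measurable)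
    also have "\<dots> \<le> (\<Sum>m\<in>(UNIV :: 'n set). 4 / real n powr (1 + \<alpha>))"
      by (intro sum_mono tail)
    also have "\<dots> = 4 / real n powr \<alpha>"
      using True by (simp add: powr_add flip: assms(1))
    finally show ?thesis
      by (simp add: prob_compl)
  qed
  moreover have "1 / real n * (norm (\<theta>hat \<omega> - \<theta>star))\<^sup>2
      \<le> 12 * \<sigma>\<^sup>2 * (real (s\<^sub>1 + s\<^sub>2) / real n) * ln (exp 1 * real n / real (s\<^sub>1 + s\<^sub>2))
        + 48 * (\<alpha> + 2) * \<sigma>\<^sup>2 * real (s\<^sub>1 + s\<^sub>2) * (ln (real n) / real n)" if "\<omega> \<in> E" for \<omega>
  proof -
    have "\<omega> \<in> space M"
      using that by (simp add: E_def)
    \<comment> \<open>The competitor is \<theta>star itself, whose residual is the noise.\<close>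
    then have "\<theta>hat \<omega> \<in> unimodal" and "(norm (\<theta>star + Z \<omega> - \<theta>hat \<omega>))\<^sup>2 \<le> (norm (Z \<omega>))\<^sup>2"
      using assms(9)[of \<omega>] assms(7) unfolding is_arg_min_linorder by (auto dest: bspec[of _ _ \<theta>star])
    then obtain m where "\<theta>hat \<omega> \<in> mode_cone m"
      by (auto simp: unimodal_def)
    then have "\<theta>hat \<omega> - \<theta>star \<in> K m"
      unfolding K_def by (rule mode_cone_diff_block_monotone)
    then have "Z \<omega> \<bullet> (\<theta>hat \<omega> - \<theta>star) \<le> norm (\<theta>hat \<omega> - \<theta>star) * cone_sup (K m) (Z \<omega>)"
      by (intro inner_le_cone_sup K0) (auto simp: K_def intro: block_monotone_scaleR)
    then have "(norm (\<theta>hat \<omega> - \<theta>star))\<^sup>2 \<le> 4 * (cone_sup (K m) (Z \<omega>))\<^sup>2"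
      using \<open>(norm (\<theta>star + Z \<omega> - \<theta>hat \<omega>))\<^sup>2 \<le> _\<close> by (intro least_squares_error_le cone_sup_nonneg K0)
    also have "\<dots> \<le> 4 * t"
      using that by (simp add: E_def)
    also have "\<dots> \<le> 12 * \<sigma>\<^sup>2 * real s * ln (exp 1 * real n / real s) + 48 * (\<alpha> + 2) * \<sigma>\<^sup>2 * real s * ln (real n)"
      unfolding t_def using True s assms(10) by (rule risk_threshold_le)
    finally have "(norm (\<theta>hat \<omega> - \<theta>star))\<^sup>2 / real n
        \<le> (12 * \<sigma>\<^sup>2 * real s * ln (exp 1 * real n / real s) + 48 * (\<alpha> + 2) * \<sigma>\<^sup>2 * real s * ln (real n)) / real n"
      by (rule divide_right_mono) simp
    then show ?thesis
      unfolding s_def[symmetric] by (simp add: add_divide_distrib)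
  qed
  ultimately show ?thesis
    using \<open>E \<in> sets M\<close> by blast
qed

end
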